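(* Let $c=0$ and $0<p<1$. (i) The map $L_{0,p}$ generates for Lebesgue almost every $x\in[0,1]$ uncountably many universal generalised Lüroth expansions. (ii) The speed of convergence of the sequence $\big(\frac{p_n}{q_n}\big)_n$ to $x$ for any generalised Lüroth expansion produced by $L_{0,p}$ typically satisfies $$\lim_{n\to\infty}\frac1n\log\Big|x-\frac{p_n}{q_n}\Big|=-\sum_{d=2}^\infty\frac{\log(d(d-1))}{d(d-1)},$$ and the range of possible values of this rate is $(-\infty,-\log2]$. In particular, this rate does not depend on $p$. (iii) Typically the approximation coefficients generated by $L_{0,p}$ satisfy $$\lim_{n\to\infty}\frac1n\sum_{i=1}^n\theta_i^{0,p}=p\,\frac{2\zeta(2)-3}{2}+\frac{2-\zeta(2)}{2},$$ where $\zeta(2)$ is the zeta function evaluated at $2$. In particular, this limit can attain any value in the interval $[M_A,M_L]$.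
   Context: $\lambda$ is Lebesgue measure on $[0,1]$ and $m_p$ is the $(p,1-p)$-Bernoulli measure on $\{0,1\}^{\mathbb N}$ (symbol $0$ has probability $p$). "Typically" means for $m_p\times\lambda$-a.e. $(\omega,x)\in\{0,1\}^{\mathbb N}\times[0,1]$. The constants are $M_A=1-\frac{\zeta(2)}2$ and $M_L=\frac{\zeta(2)}2-\frac12$. Let $T_L:[0,1]\to[0,1]$ be the Lüroth map, $T_L(0)=0$, $T_L(1)=1$ and $T_L(x)=\lceil\frac1x\rceil(\lceil\frac1x\rceil-1)x-(\lceil\frac1x\rceil-1)$ for $x\ne0,1$, and let $T_A=1-T_L$ be the alternating Lüroth map. Put $z_n=\frac1n$, $n\ge1$. Let $T_0=T_L$ and $T_1=T_A$, except that $T_0(z_n)=T_1(z_n)=1$ for all $n\ge1$ and $T_0(0)=T_1(0)=1$. The random Lüroth map $L_{0,p}:\{0,1\}^{\mathbb N}\times[0,1]\to\{0,1\}^{\mathbb N}\times[0,1]$ is $L_{0,p}(\omega,x)=(\sigma(\omega),T_{\omega_1}(x))$, with $\sigma$ the left shift; $p$ is the probability with which $T_0$ is applied. Write $T_\omega^n=T_{\omega_n}\circ\cdots\circ T_{\omega_1}$ and $T_\omega^0=\mathrm{id}$. For $x\neq0$ and $i\ge1$ put $s_i=s_i(\omega,x)=\omega_i$, and let $d_i=d_i(\omega,x)=2$ if $T_\omega^{i-1}(x)=1$ and $d_i=n$ if $T_\omega^{i-1}(x)\in[\frac1n,\frac1{n-1})$, $n\ge2$. The sequence $((s_i,d_i))_{i\ge1}$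 is the generalised Lüroth expansion produced by $L_{0,p}$ for $(\omega,x)$, corresponding to $$x=\sum_{n\ge1}(-1)^{\sum_{i=1}^{n-1}s_i}\frac{d_n-1+s_n}{\prod_{i=1}^nd_i(d_i-1)}.$$ It is called universal if every finite block of elements of the alphabet $\{0,1\}\times\mathbb N_{\ge2}$ occurs in it. The convergents are $$\frac{p_n}{q_n}=\frac{p_n}{q_n}(\omega,x)=\sum_{k=1}^n(-1)^{\sum_{i=1}^{k-1}s_i}\frac{d_k-1+s_k}{\prod_{i=1}^kd_i(d_i-1)},\qquad q_n=(d_n-s_n)\prod_{i=1}^{n-1}d_i(d_i-1),$$ and the approximation coefficients are $\theta_n^{0,p}=\theta_n^{0,p}(\omega,x)=q_n\big|x-\frac{p_n}{q_n}\big|$.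
   Formalization: The end points M_A and M_L are attained only at p=0 and p=1, so p ranges over [0,1] for the closed interval and (0,1) for the open one; the range of rates is over x in (0,1] and expansions whose series converges to x, since x=1/2 with ω=000… would give rate 0. *)

theory Defs
  imports "HOL-Probability.Probability"
begin

section \<open>The random Lueroth map\<close>

definition luroth :: "real \<Rightarrow> real" where
  "luroth x =
     (if x = 0 then 0 else if x = 1 then 1
      else of_int (\<lceil>1 / x\<rceil> * (\<lceil>1 / x\<rceil> - 1)) * x - of_int (\<lceil>1 / x\<rceil> - 1))"

definition alt_luroth :: "real \<Rightarrow> real" where
  "alt_luroth x = 1 - luroth x"

text \<open>
  The symbol space \<open>{0,1}\<^sup>\<nat>\<close> is rendered as \<^typ>\<open>bool stream\<close>, with \<^const>\<open>False\<close> for \<open>0\<close> and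
  \<^const>\<open>True\<close> for \<open>1\<close>. Streams are indexed from \<open>0\<close>, so \<open>\<omega>\<^sub>i\<close> is \<open>\<omega> !! (i - 1)\<close>.
\<close>

definition fibre_map :: "bool \<Rightarrow> real \<Rightarrow> real" where
  "fibre_map s x =
     (if x = 0 \<or> (\<exists>n::nat. n \<ge> 1 \<and> x = 1 / real n) then 1
      else if s then alt_luroth x else luroth x)"

definition random_luroth :: "bool stream \<times> real \<Rightarrow> bool stream \<times> real" where
  "random_luroth = (\<lambda>(\<omega>, x). (stl \<omega>, fibre_map (shd \<omega>) x))"

primrec orbit :: "bool stream \<Rightarrow> nat \<Rightarrow> real \<Rightarrow> real" where
  "orbit \<omega> 0 x = x"
| "orbit \<omega> (Suc n) x = fibre_map (\<omega> !! n) (orbit \<omega> n x)"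

lemma random_luroth_funpow: "(random_luroth ^^ n) (\<omega>, x) = (sdrop n \<omega>, orbit \<omega> n x)"
  by (induction n) (simp_all add: random_luroth_def sdrop_stl flip: sdrop_simps)

definition bernoulli_measure :: "real \<Rightarrow> bool stream measure" where
  "bernoulli_measure p = stream_space (measure_pmf (bernoulli_pmf (1 - p)))"

abbreviation luroth_measure :: "real \<Rightarrow> (bool stream \<times> real) measure" where
  "luroth_measure p \<equiv> bernoulli_measure p \<Otimes>\<^sub>M lebesgue_on {0..1}"

section \<open>Generalised Lueroth expansions\<close>

definition digit :: "real \<Rightarrow> nat" where
  "digit y = (if y = 1 then 2
              else (THE n. n \<ge> 2 \<and> y \<in> {1 / real n ..< 1 / (real n - 1)}))"

lemma digit_eqI:
  assumes "n \<ge> 2" "y \<in> {1 / real n ..< 1 / (real n - 1)}"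
  shows "digit y = n"
proof -
  have ceil: "int m = \<lceil>1 / y\<rceil>"
    if "m \<ge> 2" "y \<in> {1 / real m ..< 1 / (real m - 1)}" for m :: nat
  proof -
    have "0 < 1 / real m" using that by simp
    also have "\<dots> \<le> y" using that by simp
    finally have "y > 0" .
    with that have "1 / y \<le> real m" "real m - 1 < 1 / y"
      by (auto simp: field_simps)
    then show ?thesis by linarith
  qed
  have "1 / (real n - 1) \<le> 1" using assms(1) by simp
  then have "y \<noteq> 1" using assms(2) by auto
  then have "digit y = (THE n. n \<ge> 2 \<and> y \<in> {1 / real n ..< 1 / (real n - 1)})"
    unfolding digit_def by (simp only: if_False)
  also have "\<dots> = n"
    using ceil assms by (intro the_equality) (metis of_nat_eq_iff)+
  finally show ?thesis .
qed

text \<open>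
  A digit sequence \<open>e\<close> is indexed from \<open>0\<close>; \<open>sign_of e i\<close> and \<open>digit_of e i\<close> are \<open>s\<^sub>i\<close> and \<open>d\<^sub>i\<close>
  for \<open>i \<ge> 1\<close>.
\<close>

definition expansion :: "bool stream \<Rightarrow> real \<Rightarrow> nat \<Rightarrow> bool \<times> nat" where
  "expansion \<omega> x = (\<lambda>i. (\<omega> !! i, digit (orbit \<omega> i x)))"

definition sign_of :: "(nat \<Rightarrow> bool \<times> nat) \<Rightarrow> nat \<Rightarrow> nat" where
  "sign_of e i = of_bool (fst (e (i - 1)))"

definition digit_of :: "(nat \<Rightarrow> bool \<times> nat) \<Rightarrow> nat \<Rightarrow> nat" where
  "digit_of e i = snd (e (i - 1))"

text \<open>The convergent \<open>p\<^sub>n / q\<^sub>n\<close> and the denominator \<open>q\<^sub>n\<close>, the latter for \<open>n \<ge> 1\<close>.\<close>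

definition convergent_of :: "(nat \<Rightarrow> bool \<times> nat) \<Rightarrow> nat \<Rightarrow> real" where
  "convergent_of e n =
     (\<Sum>k = 1..n. (- 1) ^ (\<Sum>i = 1..k - 1. sign_of e i) *
        ((real (digit_of e k) - 1 + real (sign_of e k)) /
         (\<Prod>i = 1..k. real (digit_of e i) * (real (digit_of e i) - 1))))"

definition denominator_of :: "(nat \<Rightarrow> bool \<times> nat) \<Rightarrow> nat \<Rightarrow> real" where
  "denominator_of e n =
     (real (digit_of e n) - real (sign_of e n)) *
     (\<Prod>i = 1..n - 1. real (digit_of e i) * (real (digit_of e i) - 1))"

definition approx_coeff :: "bool stream \<Rightarrow> real \<Rightarrow> nat \<Rightarrow> real" where
  "approx_coeff \<omega> x n =
     denominator_of (expansion \<omega> x) n * \<bar>x - convergent_of (expansion \<omega> x) n\<bar>"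

text \<open>
  The convergence requirement says that \<open>x\<close> is the value of the series. It only matters for
  orbits that hit some \<open>1 / n\<close>, where both fibre maps were redefined to be \<open>1\<close>: for \<open>x = 1 / 2\<close> and
  \<open>\<omega> = 000\<dots>\<close> the digits produced are \<open>(0,2), (0,2), \<dots>\<close>, whose series has the value \<open>1\<close>.
\<close>

definition expansions :: "real \<Rightarrow> (nat \<Rightarrow> bool \<times> nat) set" where
  "expansions x = {expansion \<omega> x | \<omega>. convergent_of (expansion \<omega> x) \<longlonglongrightarrow> x}"

definition universal :: "(nat \<Rightarrow> bool \<times> nat) \<Rightarrow> bool" where
  "universal e \<longleftrightarrow>
     (\<forall>b. set b \<subseteq> UNIV \<times> {2..} \<longrightarrow> (\<exists>k. \<forall>j < length b. e (k + j) = b ! j))"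

definition converges_at_rate :: "(nat \<Rightarrow> bool \<times> nat) \<Rightarrow> real \<Rightarrow> real \<Rightarrow> bool" where
  "converges_at_rate e x r \<longleftrightarrow> (\<lambda>n. 1 / real n * ln \<bar>x - convergent_of e n\<bar>) \<longlonglongrightarrow> r"

section \<open>Constants\<close>

text \<open>The Dirichlet series, meaningful for \<open>s > 1\<close>.\<close>

definition zeta :: "real \<Rightarrow> real" where
  "zeta s = (\<Sum>n. 1 / real (Suc n) powr s)"

definition M_A :: real where "M_A = 1 - zeta 2 / 2"

definition M_L :: real where "M_L = zeta 2 / 2 - 1 / 2"

end

theory Submission
  imports Defs "HOL-Library.Discrete_Functions"
begin

text \<open>
  For irrational \<open>x\<close> every orbit point is recovered from the next one by an inverse branch, so
  \<open>\<bar>x - p\<^sub>n/q\<^sub>n\<bar>\<close> equals \<open>T\<^sup>n x\<close> divided by the product of the \<open>d\<^sub>i(d\<^sub>i - 1)\<close>, and the \<open>n\<close>-th approximation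
  coefficient is \<open>T\<^sup>n x/(d\<^sub>n - 1)\<close> or \<open>T\<^sup>n x/d\<^sub>n\<close>. An affine substitution on the digit intervals shows that
  the letter \<open>(s\<^sub>1, d\<^sub>1)\<close> is independent of the next point, which is distributed as the first. All averages are
  then sums of reverse martingale differences, and a strong law for orthogonal sequences suffices:
  for \<open>ln (d(d - 1))\<close> directly, for \<open>T\<^sup>n x\<close> because its conditional mean given \<open>T\<^bsup>n+1\<^esup> x\<close> is affine with slope
  below 1. Rates below \<open>-ln 2\<close> are realised by digits from \<open>{2, D}\<close> distributed along a Beatty sequence,
  and uncountability follows from Fubini because the Bernoulli measure has no atoms.
\<close>

section \<open>Inverse branches and convergents\<close>

text \<open>Almost everywhere statements need only irrational starting points, whose orbits avoid 0
  and all 1/n. The range of rates concerns every x in (0,1] and every expansion with value x: its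
  upper bound must start from mere convergence of the series, and a prescribed rate must be realised
  by a point built from its digits. The predicate \<open>tails\<close> therefore speaks of a digit
  sequence only, and the orbit is one instance of it.

  An approximation coefficient is a function of a letter times the next orbit point. Subtracting the
  mean of that function makes the product centred given the next point, but leaves a multiple of the
  average of the orbit. This average is found from the affine conditional mean, because a slope
  different from 1 allows one to solve for it.

  The strong law is stated for second moments rather than for bounded functions because the
  logarithms of the digits are unbounded. The law of a digit is the same for both fibre maps, so p
  cannot enter the rate; it enters the mean approximation coefficient through the choice between
  1/(d - 1) and 1/d.\<close>

definition weight :: "bool \<times> nat \<Rightarrow> real" where
  "weight c = real (snd c) * (real (snd c) - 1)"

text \<open>This is the inverse of \<open>fibre_map s\<close> on the interval of digit d, where the
  fibre map has slope \<open>weight\<close> up to sign. Its value at 0 is the numerator d - 1 + s of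
  the series over the weight.\<close>

definition branch :: "bool \<times> nat \<Rightarrow> real \<Rightarrow> real" where
  "branch c y = (real (snd c) - 1 + (if fst c then 1 - y else y)) / weight c"

lemma weight_ge_2:
  assumes "2 \<le> snd c"
  shows "2 \<le> weight c"
proof -
  have "2 * 1 \<le> real (snd c) * (real (snd c) - 1)"
    by (rule mult_mono) (use assms in auto)
  then show ?thesis by (simp add: weight_def)
qed

text \<open>The left end 1/d of the digit interval as a lower bound gives strict positivity of
  limits of tails, and later bounds the logarithm of a tail by that of a weight.\<close>

lemma branch_pos:
  assumes "2 \<le> snd c" "0 \<le> y" "y \<le> 1"
  shows "1 / real (snd c) \<le> branch c y"
proof -
  have "real (snd c) \<ge> 2" using assms(1) by simp
  then show ?thesis using assms
    by (auto simp: branch_def weight_def field_simps)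
qed

lemma digit_bounds:
  assumes "0 < y" "y < 1"
  shows "digit y = nat \<lceil>1 / y\<rceil>" "2 \<le> digit y"
    "1 / real (digit y) \<le> y" "y < 1 / (real (digit y) - 1)"
proof -
  define n where "n = nat \<lceil>1 / y\<rceil>"
  have "1 < 1 / y" using assms by simp
  then have "2 \<le> \<lceil>1 / y\<rceil>" by linarith
  then have n: "real n = of_int \<lceil>1 / y\<rceil>" "2 \<le> n" unfolding n_def by linarith+
  have "1 / y \<le> real n" "real n - 1 < 1 / y" unfolding n(1) by linarith+
  then have b: "1 / real n \<le> y" "y < 1 / (real n - 1)"
    using n(2) assms by (auto simp: field_simps)
  then have "digit y = n" using n(2) by (intro digit_eqI) auto
  then show "digit y = nat \<lceil>1 / y\<rceil>" "2 \<le> digit y"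
    "1 / real (digit y) \<le> y" "y < 1 / (real (digit y) - 1)"
    using n b n_def by auto
qed

lemma digit_1 [simp]: "digit 1 = 2"
  by (simp add: digit_def)

lemma luroth_eq:
  assumes "0 < y" "y < 1"
  shows "luroth y = weight (s, digit y) * y - (real (digit y) - 1)"
proof -
  have "real (digit y) = of_int \<lceil>1 / y\<rceil>"
    using digit_bounds(1,2)[OF assms] by linarith
  then show ?thesis using assms by (simp add: luroth_def weight_def)
qed

definition special :: "real \<Rightarrow> bool" where
  "special x \<longleftrightarrow> x = 0 \<or> (\<exists>n::nat. n \<ge> 1 \<and> x = 1 / real n)"

lemma fibre_map_special: "special x \<Longrightarrow> fibre_map s x = 1"
  by (simp add: fibre_map_def special_def)

lemma not_special_1: "\<not> special y \<Longrightarrow> y \<noteq> 1"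
  unfolding special_def by (auto dest: spec[of _ "1::nat"])

lemma branch_fibre_map:
  assumes "0 < y" "y \<le> 1" "\<not> special y"
  shows "branch (s, digit y) (fibre_map s y) = y"
    and "0 < fibre_map s y" and "fibre_map s y < 1"
proof -
  have y: "y < 1" using assms not_special_1[of y] by force
  note d = digit_bounds[OF assms(1) y]
  have f: "fibre_map s y = (if s then 1 - luroth y else luroth y)"
    using assms(3) unfolding special_def fibre_map_def alt_luroth_def by auto
  have w: "weight (s, digit y) \<ge> 2" using d(2) weight_ge_2[of "(s, digit y)"] by simp
  \<comment> \<open>The left end of a digit interval is one of the redefined points. Excluding it
    makes both inequalities for y strict, so the image lies in the open unit interval.\<close>
  have ne: "1 / real (digit y) \<noteq> y" using assms(3) d(2) unfolding special_def
    by (metis One_nat_def Suc_1 Suc_leD)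
  then have lt: "1 / real (digit y) < y" using d(3) by simp
  have dd: "real (digit y) \<ge> 2" using d(2) by simp
  have "1 < real (digit y) * y" "(real (digit y) - 1) * y < 1"
    using lt d(4) dd by (auto simp: field_simps)
  then have "(real (digit y) - 1) * 1 < (real (digit y) - 1) * (real (digit y) * y)"
    "real (digit y) * ((real (digit y) - 1) * y) < real (digit y) * 1"
    using dd by (intro mult_strict_left_mono; simp)+
  then have l: "0 < luroth y" "luroth y < 1"
    unfolding luroth_eq[OF assms(1) y, of s] by (auto simp: weight_def mult_ac)
  show "branch (s, digit y) (fibre_map s y) = y"
    unfolding f using luroth_eq[OF assms(1) y, of s] w by (cases s) (simp_all add: branch_def)
  show "0 < fibre_map s y" "fibre_map s y < 1" unfolding f using l by auto
qed

lemma orbit_in: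
  assumes "0 < x" "x \<le> 1"
  shows "0 < orbit \<omega> n x \<and> orbit \<omega> n x \<le> 1"
proof (induction n)
  case 0
  then show ?case using assms by simp
next
  case (Suc n)
  then show ?case
    using branch_fibre_map(2,3)[of "orbit \<omega> n x"] fibre_map_special[of "orbit \<omega> n x"]
    by (cases "special (orbit \<omega> n x)") (auto simp: less_imp_le)
qed

lemma digit_orbit_ge_2:
  assumes "0 < x" "x \<le> 1"
  shows "2 \<le> snd (expansion \<omega> x n)"
  using orbit_in[OF assms, of \<omega> n] digit_bounds(2)[of "orbit \<omega> n x"]
  by (cases "orbit \<omega> n x = 1") (auto simp: expansion_def)

lemma branch_Rats: "y \<in> \<rat> \<Longrightarrow> branch c y \<in> \<rat>"
  by (simp add: branch_def weight_def)

text \<open>Inverse branches have rational coefficients, so a rational next point would force the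
  current point to be rational.\<close>

lemma orbit_irrational:
  assumes "0 < x" "x \<le> 1" "x \<notin> \<rat>"
  shows "orbit \<omega> n x \<notin> \<rat>"
proof (induction n)
  case 0
  then show ?case using assms by simp
next
  case (Suc n)
  then have "\<not> special (orbit \<omega> n x)" by (auto simp: special_def)
  then have "branch (\<omega> !! n, digit (orbit \<omega> n x)) (orbit \<omega> (Suc n) x) = orbit \<omega> n x"
    using branch_fibre_map(1)[of "orbit \<omega> n x" "\<omega> !! n"] orbit_in[OF assms(1,2), of \<omega> n]
    by simp
  then show ?case using Suc branch_Rats by metis
qed

lemma branch_orbit:
  assumes "0 < x" "x \<le> 1" "x \<notin> \<rat>"
  shows "branch (expansion \<omega> x n) (orbit \<omega> (Suc n) x) = orbit \<omega> n x"
proof -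
  have "\<not> special (orbit \<omega> n x)"
    using orbit_irrational[OF assms, of \<omega> n] by (auto simp: special_def)
  then show ?thesis
    using branch_fibre_map(1)[of "orbit \<omega> n x" "\<omega> !! n"] orbit_in[OF assms(1,2), of \<omega> n]
    by (simp add: expansion_def)
qed

definition sgn_upto :: "(nat \<Rightarrow> bool \<times> nat) \<Rightarrow> nat \<Rightarrow> real" where
  "sgn_upto e n = (\<Prod>i<n. if fst (e i) then -1 else 1)"

definition weight_upto :: "(nat \<Rightarrow> bool \<times> nat) \<Rightarrow> nat \<Rightarrow> real" where
  "weight_upto e n = (\<Prod>i<n. weight (e i))"

lemma sgn_upto_Suc: "sgn_upto e (Suc n) = sgn_upto e n * (if fst (e n) then -1 else 1)"
  by (simp add: sgn_upto_def)

lemma weight_upto_Suc: "weight_upto e (Suc n) = weight_upto e n * weight (e n)"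
  by (simp add: weight_upto_def)

lemma convergent_of_Suc:
  "convergent_of e (Suc n) = convergent_of e n +
     sgn_upto e n * (real (snd (e n)) - 1 + of_bool (fst (e n))) / weight_upto e (Suc n)"
proof -
  have "(- 1) ^ (\<Sum>i = 1..n. sign_of e i) = sgn_upto e n"
    unfolding power_sum sgn_upto_def
    by (simp add: prod.atLeast1_atMost_eq sign_of_def) (intro prod.cong, auto)
  moreover have "(\<Prod>i = 1..Suc n. real (digit_of e i) * (real (digit_of e i) - 1)) = weight_upto e (Suc n)"
    by (simp add: weight_upto_def prod.atLeast1_atMost_eq digit_of_def weight_def prod.lessThan_Suc)
  ultimately show ?thesis
    by (simp add: convergent_of_def sign_of_def digit_of_def)
qed

lemma denominator_of_Suc:
  "denominator_of e (Suc n) = (real (snd (e n)) - of_bool (fst (e n))) * weight_upto e n"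
  by (simp add: denominator_of_def digit_of_def sign_of_def weight_upto_def weight_def
      prod.atLeast1_atMost_eq)

definition admissible :: "(nat \<Rightarrow> bool \<times> nat) \<Rightarrow> bool" where
  "admissible e \<longleftrightarrow> (\<forall>n. 2 \<le> snd (e n))"

text \<open>\<open>v n\<close> plays the role of the value of the series read from place n on.
  Strict positivity keeps the errors nonzero, so that their logarithms are meaningful.\<close>

definition tails :: "(nat \<Rightarrow> bool \<times> nat) \<Rightarrow> (nat \<Rightarrow> real) \<Rightarrow> bool" where
  "tails e v \<longleftrightarrow> (\<forall>n. v n = branch (e n) (v (Suc n)) \<and> 0 < v n \<and> v n \<le> 1)"

lemma tails_pos: "tails e v \<Longrightarrow> 0 < v n \<and> v n \<le> 1"
  unfolding tails_def by blast

lemma admissible_weight: "admissible e \<Longrightarrow> 2 \<le> weight (e n)"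
  by (simp add: admissible_def weight_ge_2)

lemma weight_upto_ge:
  assumes "admissible e"
  shows "2 ^ n \<le> weight_upto e n"
proof (induction n)
  case 0
  then show ?case by (simp add: weight_upto_def)
next
  case (Suc n)
  have "2 ^ n * 2 \<le> weight_upto e n * weight (e n)"
    using Suc admissible_weight[OF assms, of n]
    by (intro mult_mono) (auto intro: order_trans[OF zero_le_power[of 2 n]])
  then show ?case by (simp add: weight_upto_def mult.commute)
qed

lemma weight_upto_pos: "admissible e \<Longrightarrow> 0 < weight_upto e n"
  by (rule less_le_trans[OF _ weight_upto_ge]) simp_all

lemma sgn_upto_cases: "sgn_upto e n = 1 \<or> sgn_upto e n = -1"
  by (induction n) (auto simp: sgn_upto_def)

text \<open>The composition of the first n inverse branches is affine with slope
  \<open>sgn_upto e n / weight_upto e n\<close>, and the n-th convergent is its value at 0.\<close>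

lemma tail_of_convergent:
  assumes "admissible e" "tails e v"
  shows "v 0 - convergent_of e n = sgn_upto e n * v n / weight_upto e n"
proof (induction n)
  case 0
  then show ?case by (simp add: convergent_of_def sgn_upto_def weight_upto_def)
next
  case (Suc n)
  have "weight (e n) \<noteq> 0" "weight_upto e n \<noteq> 0"
    using admissible_weight[OF assms(1), of n] weight_upto_pos[OF assms(1), of n] by auto
  moreover have "v n = branch (e n) (v (Suc n))" using assms(2) unfolding tails_def by blast
  ultimately have "sgn_upto e n * v n / weight_upto e n =
      sgn_upto e n * (real (snd (e n)) - 1 + of_bool (fst (e n))) / weight_upto e (Suc n)
      + sgn_upto e (Suc n) * v (Suc n) / weight_upto e (Suc n)"
    by (simp add: branch_def sgn_upto_Suc weight_upto_Suc divide_simps) (simp add: algebra_simps)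
  then show ?case using Suc by (simp add: convergent_of_Suc)
qed

lemma convergent_error:
  assumes "admissible e" "tails e v"
  shows "\<bar>v 0 - convergent_of e n\<bar> = v n / weight_upto e n"
proof -
  have "0 < v n" using assms(2) unfolding tails_def by blast
  then show ?thesis
    unfolding tail_of_convergent[OF assms]
    using sgn_upto_cases[of e n] weight_upto_pos[OF assms(1), of n]
    by (auto simp: abs_mult)
qed

text \<open>The rescaled errors obey the branch recursion, and the inverse branches expand the distance
  to \<open>[0,1]\<close>. A tail outside \<open>[0,1]\<close> would therefore keep the error bounded away from 0.\<close>

lemma convergent_imp_tails:
  assumes e: "admissible e" and lim: "convergent_of e \<longlonglongrightarrow> x"
  obtains v where "v 0 = x" "tails e v"
proof -
  have W: "0 < weight_upto e n" for n by (rule weight_upto_pos[OF e])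
  have w: "2 \<le> weight (e n)" for n by (rule admissible_weight[OF e])
  have d: "2 \<le> snd (e n)" for n using e by (simp add: admissible_def)
  \<comment> \<open>This solves the identity of \<open>tail_of_convergent\<close> for
    \<open>v n\<close>; the sign is its own inverse.\<close>
  define v where "v n = (x - convergent_of e n) * sgn_upto e n * weight_upto e n" for n
  have rec: "v n = branch (e n) (v (Suc n))" for n
    unfolding v_def convergent_of_Suc branch_def using W[of n] w[of n] sgn_upto_cases[of e n]
    by (auto simp: sgn_upto_Suc weight_upto_Suc divide_simps) (auto simp: algebra_simps)
  \<comment> \<open>Signed distance to [0,1]: positive exactly outside the interval, where it equals
    the distance.\<close>
  define \<delta> where "\<delta> n = max (- v n) (v n - 1)" for n
  have step: "weight (e n) * \<delta> n \<le> \<delta> (Suc n)" for n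
  proof -
    have dd: "real (snd (e n)) \<ge> 2" using d[of n] by simp
    have "weight (e n) * v n = real (snd (e n)) - 1 + (if fst (e n) then 1 - v (Suc n) else v (Suc n))"
      using rec[of n] w[of n] by (simp add: branch_def)
    moreover have "weight (e n) \<ge> real (snd (e n))" 
      using dd by (simp add: weight_def)
    ultimately have "weight (e n) * (- v n) \<le> \<delta> (Suc n)" "weight (e n) * (v n - 1) \<le> \<delta> (Suc n)"
      using dd unfolding \<delta>_def right_diff_distrib by (auto split: if_splits)
    then show ?thesis unfolding \<delta>_def[of n] by (simp add: max_def)
  qed
  have le1: "\<delta> N \<le> 0" for N
  proof (rule ccontr)
    assume "\<not> \<delta> N \<le> 0"
    then have pos: "0 < \<delta> N / weight_upto e N" using W by simp
    have mono: "\<delta> N / weight_upto e N \<le> \<delta> (N + k) / weight_upto e (N + k)" for k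
    proof (induction k)
      case 0
      then show ?case by simp
    next
      case (Suc k)
      have "\<delta> (N + k) / weight_upto e (N + k) \<le> \<delta> (N + Suc k) / weight_upto e (N + Suc k)"
        using step[of "N + k"] W[of "N + k"] w[of "N + k"]
        by (simp add: weight_upto_Suc divide_simps mult_ac)
      then show ?case using Suc by linarith
    qed
    have bd: "\<delta> n / weight_upto e n \<le> \<bar>x - convergent_of e n\<bar>" for n
    proof -
      have "\<delta> n \<le> \<bar>v n\<bar>" unfolding \<delta>_def by linarith
      also have "\<dots> = \<bar>x - convergent_of e n\<bar> * weight_upto e n"
        unfolding v_def using sgn_upto_cases[of e n] W[of n] by (auto simp: abs_mult)
      finally show ?thesis using W[of n] by (simp add: field_simps)
    qed
    have "(\<lambda>k. \<bar>x - convergent_of e (k + N)\<bar>) \<longlonglongrightarrow> \<bar>x - x\<bar>"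
      by (intro tendsto_intros LIMSEQ_ignore_initial_segment lim)
    then have "\<delta> N / weight_upto e N \<le> \<bar>x - x\<bar>"
      using mono bd by (intro tendsto_lowerbound[where F = sequentially])
        (auto intro!: always_eventually intro: order_trans simp: add.commute)
    then show False using pos by simp
  qed
  then have 01: "0 \<le> v n" "v n \<le> 1" for n using le1[of n] unfolding \<delta>_def by auto
  have "0 < v n" for n
  proof -
    have "0 < 1 / real (snd (e n))" using d[of n] by simp
    also have "\<dots> \<le> v n" unfolding rec[of n] by (intro branch_pos d 01)
    finally show ?thesis .
  qed
  moreover have "v 0 = x" by (simp add: v_def convergent_of_def sgn_upto_def weight_upto_def)
  ultimately show thesis using that rec 01 unfolding tails_def by blast
qed

lemma tails_imp_convergent:
  assumes "admissible e" "tails e v"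
  shows "convergent_of e \<longlonglongrightarrow> v 0"
proof -
  have "\<bar>v 0 - convergent_of e n\<bar> \<le> (1 / 2) ^ n" for n
  proof -
    have "v n / weight_upto e n \<le> 1 / 2 ^ n"
      using weight_upto_ge[OF assms(1), of n] tails_pos[OF assms(2), of n]
      by (intro frac_le) auto
    then show ?thesis
      unfolding convergent_error[OF assms] by (simp add: power_divide)
  qed
  then have "(\<lambda>n. convergent_of e n - v 0) \<longlonglongrightarrow> 0"
    by (intro Lim_null_comparison[OF _ LIMSEQ_realpow_zero[of "1/2"]])
       (auto intro!: always_eventually simp: abs_minus_commute)
  then show ?thesis by (simp add: LIM_zero_iff)
qed

lemma ln_convergent_error:
  assumes "admissible e" "tails e v"
  shows "ln \<bar>v 0 - convergent_of e n\<bar> = ln (v n) - (\<Sum>i<n. ln (weight (e i)))"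
proof -
  have "weight (e i) > 0" for i using admissible_weight[OF assms(1), of i] by simp
  then have "ln (weight_upto e n) = (\<Sum>i<n. ln (weight (e i)))"
    unfolding weight_upto_def by (intro ln_prod) (auto simp: less_le)
  moreover have "0 < v n" using tails_pos[OF assms(2)] by simp
  ultimately show ?thesis
    unfolding convergent_error[OF assms] using weight_upto_pos[OF assms(1), of n]
    by (simp add: ln_div)
qed

lemma expansion_admissible: "0 < x \<Longrightarrow> x \<le> 1 \<Longrightarrow> admissible (expansion \<omega> x)"
  by (simp add: admissible_def digit_orbit_ge_2)

lemma expansion_tails:
  assumes "0 < x" "x \<le> 1" "x \<notin> \<rat>"
  shows "tails (expansion \<omega> x) (\<lambda>n. orbit \<omega> n x)"
  using branch_orbit[OF assms] orbit_in[OF assms(1,2)] by (simp add: tails_def)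

text \<open>The product of the first n weights occurs in the denominator q and in the reciprocal of
  the error, and cancels. What remains is one letter and the point that follows it.\<close>

lemma approx_coeff_Suc:
  assumes "0 < x" "x \<le> 1" "x \<notin> \<rat>"
  shows "approx_coeff \<omega> x (Suc n) =
    (real (snd (expansion \<omega> x n)) - of_bool (fst (expansion \<omega> x n))) / weight (expansion \<omega> x n)
      * orbit \<omega> (Suc n) x"
proof -
  note a = expansion_admissible[OF assms(1,2), of \<omega>]
  show ?thesis
    using convergent_error[OF a expansion_tails[OF assms], of "Suc n"]
      weight_upto_pos[OF a, of n]
    by (simp add: approx_coeff_def denominator_of_Suc weight_upto_Suc)
qed

lemma expansion_in_expansions:
  assumes "0 < x" "x \<le> 1" "x \<notin> \<rat>"
  shows "expansion \<omega> x \<in> expansions x"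
  using tails_imp_convergent[OF expansion_admissible expansion_tails, of x \<omega>] assms
  by (auto simp: expansions_def)

section \<open>A strong law for orthogonal sequences\<close>

text \<open>Only the diagonal of the expanded square survives. An arbitrary finite index set serves
  both the initial segments and the blocks between consecutive squares.\<close>

lemma (in prob_space) orthogonal_sum_second_moment:
  fixes X :: "nat \<Rightarrow> 'a \<Rightarrow> real"
  assumes meas [measurable]: "\<And>n. X n \<in> borel_measurable M"
    and sq: "\<And>n. integrable M (\<lambda>x. (X n x)\<^sup>2)"
    and bd: "\<And>n. expectation (\<lambda>x. (X n x)\<^sup>2) \<le> C"
    and orth: "\<And>i j. i < j \<Longrightarrow> expectation (\<lambda>x. X i x * X j x) = 0"
    and fin: "finite A"
  shows "integrable M (\<lambda>x. (\<Sum>i\<in>A. X i x)\<^sup>2)"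
    and "expectation (\<lambda>x. (\<Sum>i\<in>A. X i x)\<^sup>2) \<le> C * card A"
proof -
  have int [simp]: "integrable M (\<lambda>x. X i x * X j x)" for i j
  proof (rule Bochner_Integration.integrable_bound)
    show "integrable M (\<lambda>x. (X i x)\<^sup>2 + (X j x)\<^sup>2)" using sq by simp
    have "\<bar>a * b\<bar> \<le> a\<^sup>2 + b\<^sup>2" for a b :: real
    proof -
      have "2 * \<bar>a\<bar> * \<bar>b\<bar> \<le> \<bar>a\<bar>\<^sup>2 + \<bar>b\<bar>\<^sup>2" by (rule sum_squares_bound)
      moreover have "0 \<le> \<bar>a\<bar> * \<bar>b\<bar>" by simp
      ultimately show ?thesis unfolding abs_mult power2_abs by linarith
    qed
    then show "AE x in M. norm (X i x * X j x) \<le> norm ((X i x)\<^sup>2 + (X j x)\<^sup>2)"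
      by auto
  qed measurable
  have orth': "expectation (\<lambda>x. X i x * X j x) = 0" if "i \<noteq> j" for i j
    using orth[of i j] orth[of j i] that by (cases "i < j") (auto simp: mult.commute)
  have eq: "(\<Sum>i\<in>A. X i x)\<^sup>2 = (\<Sum>i\<in>A. \<Sum>j\<in>A. X i x * X j x)" for x
    by (simp add: power2_eq_square sum_product)
  show "integrable M (\<lambda>x. (\<Sum>i\<in>A. X i x)\<^sup>2)" unfolding eq by simp
  have "expectation (\<lambda>x. (\<Sum>i\<in>A. X i x)\<^sup>2) = (\<Sum>i\<in>A. \<Sum>j\<in>A. expectation (\<lambda>x. X i x * X j x))"
    unfolding eq by (simp add: Bochner_Integration.integral_sum)
  also have "\<dots> = (\<Sum>i\<in>A. \<Sum>j\<in>A. if i = j then expectation (\<lambda>x. (X i x)\<^sup>2) else 0)"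
    by (intro sum.cong refl) (auto simp: orth' power2_eq_square)
  also have "\<dots> = (\<Sum>i\<in>A. expectation (\<lambda>x. (X i x)\<^sup>2))" using fin by simp
  also have "\<dots> \<le> C * card A" using sum_mono[of A, OF bd] by (simp add: mult.commute)
  finally show "expectation (\<lambda>x. (\<Sum>i\<in>A. X i x)\<^sup>2) \<le> C * card A" .
qed

text \<open>Convergence along squares comes from the variance of the partial sums. The second sum in
  \<open>V n\<close> controls the fluctuation between \<open>n\<^sup>2\<close> and \<open>(n + 1)\<^sup>2\<close>, and \<open>W n\<close> still has mean \<open>O(1/n\<^sup>2)\<close>.\<close>

theorem (in prob_space) orthogonal_strong_law:
  fixes X :: "nat \<Rightarrow> 'a \<Rightarrow> real"
  assumes meas [measurable]: "\<And>n. X n \<in> borel_measurable M"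
    and sq: "\<And>n. integrable M (\<lambda>x. (X n x)\<^sup>2)"
    and bd: "\<And>n. expectation (\<lambda>x. (X n x)\<^sup>2) \<le> C"
    and orth: "\<And>i j. i < j \<Longrightarrow> expectation (\<lambda>x. X i x * X j x) = 0"
  shows "AE x in M. (\<lambda>n. (\<Sum>i<n. X i x) / real n) \<longlonglongrightarrow> 0"
proof -
  have C: "0 \<le> C" using bd[of 0] by (rule order_trans[rotated]) simp
  define V where "V n x = (\<Sum>i<n\<^sup>2. X i x)\<^sup>2 +
      (\<Sum>m\<in>{n\<^sup>2..<(Suc n)\<^sup>2}. (\<Sum>i\<in>{n\<^sup>2..<m}. X i x)\<^sup>2)" for n x
  have Vnn: "0 \<le> V n x" for n x
    unfolding V_def by (intro add_nonneg_nonneg sum_nonneg) auto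
  define W where "W n x = V n x / real n ^ 4" for n x
  have Wnn: "0 \<le> W n x" for n x
    unfolding W_def using Vnn by simp
  have [measurable]: "W n \<in> borel_measurable M" for n unfolding W_def[abs_def] V_def by measurable
  have mom: "integrable M (\<lambda>x. (\<Sum>i\<in>A. X i x)\<^sup>2)"
      "expectation (\<lambda>x. (\<Sum>i\<in>A. X i x)\<^sup>2) \<le> C * card A" if "finite A" for A
    using orthogonal_sum_second_moment[of X C A] sq bd orth that by auto
  have Wint: "integrable M (W n)" for n unfolding W_def[abs_def] V_def
    using mom(1) by (intro integrable_divide Bochner_Integration.integrable_add Bochner_Integration.integrable_sum) auto
  \<comment> \<open>The constant is 1 + 9: the sum up to n^2 contributes C n^2, and each of the 2n +
    1 <= 3n block sums has at most 3n terms. At n = 0 division by zero makes \<open>W\<close>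
    vanish.\<close>
  have EW: "expectation (W n) \<le> 10 * C * inverse (real n ^ 2)" for n
  proof (cases "n = 0")
    case True
    then show ?thesis by (simp add: W_def[abs_def])
  next
    case False
    have "expectation (\<lambda>x. (\<Sum>i\<in>{n\<^sup>2..<m}. X i x)\<^sup>2) \<le> C * (3 * real n)" if "m \<in> {n\<^sup>2..<(Suc n)\<^sup>2}" for m
    proof -
      have "m < n\<^sup>2 + 2 * n + 1" using that by (simp add: power2_eq_square)
      then have "m - n\<^sup>2 \<le> 3 * n" by linarith
      then have "real (m - n\<^sup>2) \<le> 3 * real n" by linarith
      then have "C * real (card {n\<^sup>2..<m}) \<le> C * (3 * real n)" using C
        by (intro mult_left_mono) simp_all
      then show ?thesis using mom(2)[of "{n\<^sup>2..<m}"] by simp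
    qed
    then have "(\<Sum>m\<in>{n\<^sup>2..<(Suc n)\<^sup>2}. expectation (\<lambda>x. (\<Sum>i\<in>{n\<^sup>2..<m}. X i x)\<^sup>2))
        \<le> (\<Sum>m\<in>{n\<^sup>2..<(Suc n)\<^sup>2}. C * (3 * real n))" by (intro sum_mono)
    also have "\<dots> = (2 * real n + 1) * (C * (3 * real n))"
      by (simp add: power2_eq_square algebra_simps)
    also have "\<dots> \<le> (3 * real n) * (C * (3 * real n))"
      using False C by (intro mult_right_mono) auto
    also have "\<dots> = 9 * C * (real n)\<^sup>2" by (simp add: power2_eq_square)
    finally have 1: "(\<Sum>m\<in>{n\<^sup>2..<(Suc n)\<^sup>2}. expectation (\<lambda>x. (\<Sum>i\<in>{n\<^sup>2..<m}. X i x)\<^sup>2)) \<le> 9 * C * (real n)\<^sup>2" .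
    have 2: "expectation (\<lambda>x. (\<Sum>i<n\<^sup>2. X i x)\<^sup>2) \<le> C * (real n)\<^sup>2"
      using mom(2)[of "{..<n\<^sup>2}"] by (simp only: card_lessThan of_nat_power finite_lessThan)
    have "expectation (W n) = (expectation (\<lambda>x. (\<Sum>i<n\<^sup>2. X i x)\<^sup>2) +
       (\<Sum>m\<in>{n\<^sup>2..<(Suc n)\<^sup>2}. expectation (\<lambda>x. (\<Sum>i\<in>{n\<^sup>2..<m}. X i x)\<^sup>2))) / real n ^ 4"
      unfolding W_def[abs_def] V_def using mom(1)
      by (simp add: Bochner_Integration.integral_add Bochner_Integration.integral_sum)
    also have "\<dots> \<le> (10 * C * (real n)\<^sup>2) / real n ^ 4"
      by (intro divide_right_mono order_trans[OF add_mono[OF 2 1]]) auto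
    also have "\<dots> = 10 * C * inverse (real n ^ 2)"
      using False by (simp add: field_simps power_eq_if)
    finally show ?thesis .
  qed
  \<comment> \<open>The means of \<open>W\<close> are summable, so the series of \<open>W\<close> is
    finite almost everywhere and its terms tend to 0.\<close>
  have "(\<integral>\<^sup>+x. (\<Sum>n. ennreal (W n x)) \<partial>M) = (\<Sum>n. \<integral>\<^sup>+x. ennreal (W n x) \<partial>M)"
    by (intro nn_integral_suminf) measurable
  also have "\<dots> = (\<Sum>n. ennreal (expectation (W n)))"
    using Wint Wnn by (simp add: nn_integral_eq_integral)
  also have "\<dots> \<le> (\<Sum>n. ennreal (10 * C * inverse (real n ^ 2)))"
    by (intro suminf_le ennreal_leI EW) auto
  also have "\<dots> < top"
  proof -
    have "summable (\<lambda>n. 10 * C * inverse (real n ^ 2))"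
      using inverse_power_summable[of 2] by (intro summable_mult) auto
    then show ?thesis using C by (subst suminf_ennreal2) auto
  qed
  finally have "AE x in M. (\<Sum>n. ennreal (W n x)) \<noteq> \<infinity>"
    by (intro nn_integral_PInf_AE) (auto simp: less_top)
  then show ?thesis
  proof eventually_elim
    case (elim x)
    then have "summable (\<lambda>n. W n x)" using Wnn by (intro summable_suminf_not_top) auto
    then have "(\<lambda>n. W n x) \<longlonglongrightarrow> 0" by (rule summable_LIMSEQ_zero)
    moreover have "filterlim floor_sqrt at_top sequentially"
      unfolding filterlim_at_top
      by (metis eventually_sequentially le_floor_sqrt_iff)
    ultimately have lim: "(\<lambda>m. 2 * W (floor_sqrt m) x) \<longlonglongrightarrow> 0"
      using filterlim_compose[of "\<lambda>n. W n x" "nhds 0" sequentially floor_sqrt sequentially]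
      by (auto intro: tendsto_mult_right_zero)
    \<comment> \<open>With k the integer square root of m, the part of the sum beyond k^2 is one of
      the block sums collected in \<open>V k\<close>. The condition on m gives k >= 1, so the
      division by k^4 is genuine.\<close>
    have "norm (((\<Sum>i<m. X i x) / real m)\<^sup>2) \<le> 2 * W (floor_sqrt m) x" if "1 \<le> m" for m
    proof -
      define k where "k = floor_sqrt m"
      have k: "k\<^sup>2 \<le> m" "m < (Suc k)\<^sup>2" "1 \<le> k"
        using Suc_floor_sqrt_power2_gt[of m] that by (auto simp: k_def Suc_le_eq)
      have split: "(\<Sum>i<m. X i x) = (\<Sum>i<k\<^sup>2. X i x) + (\<Sum>i\<in>{k\<^sup>2..<m}. X i x)"
        using k(1) by (simp add: lessThan_atLeast0 sum.atLeastLessThan_concat)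
      have "(\<Sum>i\<in>{k\<^sup>2..<m}. X i x)\<^sup>2 \<le> (\<Sum>m\<in>{k\<^sup>2..<(Suc k)\<^sup>2}. (\<Sum>i\<in>{k\<^sup>2..<m}. X i x)\<^sup>2)"
        using k by (intro member_le_sum[of m]) auto
      moreover have "(a + b)\<^sup>2 \<le> 2 * (a\<^sup>2 + c)" if "b\<^sup>2 \<le> c" for a b c :: real
        using sum_squares_bound[of a b] that by (simp add: power2_sum)
      ultimately have "(\<Sum>i<m. X i x)\<^sup>2 \<le> 2 * V k x"
        unfolding split V_def by blast
      moreover have "real k ^ 4 \<le> (real m)\<^sup>2"
      proof -
        have "(real (k\<^sup>2))\<^sup>2 \<le> (real m)\<^sup>2" using k(1) by (intro power_mono of_nat_mono) auto
        then show ?thesis by (simp add: power2_eq_square power4_eq_xxxx mult.assoc)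
      qed
      ultimately have "(\<Sum>i<m. X i x)\<^sup>2 / (real m)\<^sup>2 \<le> 2 * V k x / real k ^ 4"
        using k(3) Vnn by (intro frac_le) auto
      then show ?thesis by (simp add: W_def power_divide flip: k_def)
    qed
    then have "(\<lambda>m. ((\<Sum>i<m. X i x) / real m)\<^sup>2) \<longlonglongrightarrow> 0"
      by (intro Lim_null_comparison[OF _ lim]) (auto simp: eventually_sequentially)
    then have "(\<lambda>m. sqrt (((\<Sum>i<m. X i x) / real m)\<^sup>2)) \<longlonglongrightarrow> sqrt 0"
      by (rule tendsto_real_sqrt)
    then show ?case unfolding real_sqrt_abs real_sqrt_zero tendsto_rabs_zero_iff .
  qed
qed

section \<open>The random map as a skew product\<close>

text \<open>The equivalence covers all real y, since the substitution in the cylinder integral runs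
  over the whole line.\<close>

lemma branch_interval:
  assumes "2 \<le> snd c"
  shows "branch c y \<in> {1 / real (snd c)<..<1 / (real (snd c) - 1)} \<longleftrightarrow> y \<in> {0<..<1}"
proof -
  have d: "real (snd c) \<ge> 2" using assms by simp
  then have "1 / real (snd c) = (real (snd c) - 1) / weight c"
    "1 / (real (snd c) - 1) = real (snd c) / weight c"
    by (auto simp: weight_def)
  moreover have "0 < weight c" using weight_ge_2[OF assms] by simp
  ultimately show ?thesis unfolding branch_def by (auto simp: divide_less_cancel)
qed

text \<open>No reciprocal 1/m lies strictly between 1/n and 1/(n - 1), because no integer lies
  strictly between n - 1 and n.\<close>

lemma digit_in_interval:
  assumes "2 \<le> n" "x \<in> {1 / real n<..<1 / (real n - 1)}"
  shows "digit x = n" "0 < x" "x < 1" "\<not> special x"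
proof -
  have n: "real n \<ge> 2" using assms(1) by simp
  show "digit x = n" using assms by (intro digit_eqI) auto
  have "0 < 1 / real n" using n by simp
  then show x: "0 < x" using assms(2) by (meson greaterThanLessThan_iff less_trans)
  have "1 / (real n - 1) \<le> 1" using n by simp
  then show "x < 1" using assms(2) by (meson greaterThanLessThan_iff less_le_trans)
  show "\<not> special x"
  proof
    assume "special x"
    then obtain m :: nat where m: "m \<ge> 1" "x = 1 / real m" using x by (auto simp: special_def)
    then have "1 / real n < 1 / real m" "1 / real m < 1 / (real n - 1)"
      using assms(2) by auto
    then have "real m < real n" "real n - 1 < real m"
      using m(1) n by (simp_all add: divide_less_eq less_divide_eq)
    then have "m < n" "real n < real (m + 1)" by simp_all
    then show False using of_nat_less_iff[of n "m + 1"] by simp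
  qed
qed

lemma branch_inj:
  assumes "2 \<le> snd c" "branch c y = branch c z"
  shows "y = z"
  using assms weight_ge_2[OF assms(1)] by (auto simp: branch_def split: if_splits)

lemma branch_digit:
  assumes "2 \<le> snd c" "y \<in> {0<..<1}"
  shows "digit (branch c y) = snd c" "fibre_map (fst c) (branch c y) = y"
    "branch c y \<in> {0<..<1}"
proof -
  have b: "branch c y \<in> {1 / real (snd c)<..<1 / (real (snd c) - 1)}"
    using branch_interval assms by blast
  note d = digit_in_interval[OF assms(1) b]
  show "digit (branch c y) = snd c" "branch c y \<in> {0<..<1}" using d by auto
  have "branch (fst c, snd c) (fibre_map (fst c) (branch c y)) = branch c y"
    using branch_fibre_map(1)[of "branch c y" "fst c"] d by auto
  then show "fibre_map (fst c) (branch c y) = y" using assms(1) by (auto intro: branch_inj)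
qed

section \<open>The law of a digit and of the point that follows it\<close>

definition digit_prob :: "nat \<Rightarrow> real" where
  "digit_prob n = (if 2 \<le> n then 1 / (real n * (real n - 1)) else 0)"

lemma digit_prob_nonneg: "0 \<le> digit_prob n"
  by (simp add: digit_prob_def)

lemma telescope_inverse_sums: "(\<lambda>n. 1 / real (Suc n) - 1 / real (Suc (Suc n))) sums 1"
proof -
  have "(\<lambda>n. 1 / real (Suc n)) \<longlonglongrightarrow> 0" by real_asymp
  then have "(\<lambda>n. 1 / real (Suc n) - 1 / real (Suc (Suc n))) sums (1 / real (Suc 0) - 0)"
    by (rule telescope_sums')
  then show ?thesis by simp
qed

text \<open>These are the lengths of the digit intervals, which fill the unit interval; in closed
  form the sum telescopes.\<close>

lemma digit_prob_sums: "digit_prob sums 1"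
proof -
  have "digit_prob (n + 2) = 1 / real (Suc n) - 1 / real (Suc (Suc n))" for n
    by (simp add: digit_prob_def field_simps)
  then have "(\<lambda>n. digit_prob (n + 2)) sums 1" using telescope_inverse_sums by simp
  then show ?thesis
    by (subst (asm) sums_iff_shift) (simp add: digit_prob_def numeral_2_eq_2)
qed

definition digit_pmf :: "nat pmf" where
  "digit_pmf = embed_pmf digit_prob"

lemma pmf_digit [simp]: "pmf digit_pmf n = digit_prob n"
  unfolding digit_pmf_def
proof (rule pmf_embed_pmf)
  have "(\<Sum>n. ennreal (digit_prob n)) = ennreal (\<Sum>n. digit_prob n)"
    using digit_prob_sums by (intro suminf_ennreal2 digit_prob_nonneg) (auto simp: sums_iff)
  then show "(\<integral>\<^sup>+n. ennreal (digit_prob n) \<partial>count_space UNIV) = 1"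
    using digit_prob_sums by (simp add: nn_integral_count_space_nat sums_iff)
qed (rule digit_prob_nonneg)

text \<open>Working with Borel sets and the open interval keeps products and measurability simple.
  The passage to Lebesgue measure on [0,1] is made by \<open>distr_lebesgue_on_unif\<close>.\<close>

abbreviation unif :: "real measure" where
  "unif \<equiv> uniform_measure lborel {0<..<1}"

lemma nn_integral_unif:
  assumes [measurable]: "f \<in> borel_measurable borel"
  shows "(\<integral>\<^sup>+x. f x \<partial>unif) = (\<integral>\<^sup>+x. f x * indicator {0<..<1} x \<partial>lborel)"
  by (subst nn_integral_uniform_measure) (auto simp: divide_ennreal_def)

lemma prob_space_unif: "prob_space unif"
  by (rule prob_space_uniform_measure) auto

text \<open>Outside (0,1] no candidate satisfies the description in \<open>digit\<close>, so all
  such points share one unspecified value; \<open>digit 3\<close> is a name for it.\<close>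

lemma digit_eq_ceiling:
  "digit y = (if y = 1 then 2 else if 0 < y \<and> y < 1 then nat \<lceil>1 / y\<rceil> else digit 3)"
proof -
  have "digit y = digit 3" if "\<not> (0 < y \<and> y < 1)" "y \<noteq> 1"
  proof -
    have no: "\<not> (n \<ge> 2 \<and> z \<in> {1 / real n ..< 1 / (real n - 1)})"
      if "\<not> (0 < z \<and> z < 1)" for z :: real and n :: nat
    proof
      assume n: "n \<ge> 2 \<and> z \<in> {1 / real n ..< 1 / (real n - 1)}"
      then have "0 < 1 / real n" "1 / (real n - 1) \<le> 1" by auto
      with n that show False by (auto simp: not_less)
    qed
    have "(\<lambda>n. n \<ge> 2 \<and> z \<in> {1 / real n ..< 1 / (real n - 1)}) = (\<lambda>_. False)"
      if "\<not> (0 < z \<and> z < 1)" for z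
      using no[OF that] by (intro ext) simp
    from this[of y] this[of 3] that show ?thesis unfolding digit_def by simp
  qed
  then show ?thesis using digit_bounds(1)[of y] by auto
qed

lemma measurable_digit [measurable]: "digit \<in> borel \<rightarrow>\<^sub>M count_space UNIV"
proof -
  have "(\<lambda>y::real. if y = 1 then 2 else if 0 < y \<and> y < 1 then nat \<lceil>1 / y\<rceil> else digit 3)
      \<in> borel \<rightarrow>\<^sub>M count_space UNIV"
    by measurable
  then show ?thesis by (subst measurable_cong[OF digit_eq_ceiling])
qed

lemma measurable_fibre_map [measurable]: "fibre_map s \<in> borel_measurable borel"
proof -
  have "{x. special x} = insert 0 (\<Union>n\<in>{1..}. {1 / real n})"
    by (auto simp: special_def)
  then have "{x. special x} \<in> sets borel" by (auto intro!: sets.countable_UN')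
  then have [measurable]: "Measurable.pred borel special"
    by (simp add: pred_def)
  have [measurable]: "luroth \<in> borel_measurable borel"
    unfolding luroth_def[abs_def] by measurable
  have "fibre_map s = (\<lambda>x. if special x then 1 else if s then 1 - luroth x else luroth x)"
    by (intro ext) (simp only: fibre_map_def special_def alt_luroth_def)
  then show ?thesis by simp
qed

lemma AE_irrational: "AE x in lborel. x \<notin> (\<rat> :: real set)"
  by (intro AE_not_in countable_imp_null_set_lborel countable_rat)

lemma AE_unif: "AE x in unif. 0 < x \<and> x < 1 \<and> x \<notin> \<rat>"
  by (rule AE_uniform_measureI) (use AE_irrational in auto)

text \<open>The two inverse branches with digit n have slopes of equal modulus, the length of the
  digit interval. This is why s leaves no trace on the right-hand side.\<close>

lemma nn_integral_cylinder:
  assumes [measurable]: "g \<in> borel_measurable borel" and n: "2 \<le> n"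
  shows "(\<integral>\<^sup>+x. g (fibre_map s x) * indicator {1 / real n<..<1 / (real n - 1)} x \<partial>lborel)
    = ennreal (digit_prob n) * (\<integral>\<^sup>+y. g y \<partial>unif)"
proof -
  define w where "w = real n * (real n - 1)"
  define t where "t = (if s then real n else real n - 1) / w"
  define c where "c = (if s then - 1 / w else 1 / w)"
  have w: "0 < w" using n by (simp add: w_def)
  have br: "branch (s, n) y = t + c * y" for y
    using w by (simp add: branch_def weight_def t_def c_def flip: w_def) (simp add: field_simps)
  have "(\<integral>\<^sup>+x. g (fibre_map s x) * indicator {1 / real n<..<1 / (real n - 1)} x \<partial>lborel)
     = ennreal \<bar>c\<bar> * (\<integral>\<^sup>+y. g (fibre_map s (branch (s, n) y)) * indicator {1 / real n<..<1 / (real n - 1)} (branch (s, n) y) \<partial>lborel)"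
    unfolding br using w by (intro nn_integral_real_affine) (auto simp: c_def)
  also have "\<dots> = ennreal \<bar>c\<bar> * (\<integral>\<^sup>+y. g y * indicator {0<..<1} y \<partial>lborel)"
  proof (rule arg_cong[where f = "\<lambda>I. ennreal \<bar>c\<bar> * I"], rule nn_integral_cong)
    fix y
    show "g (fibre_map s (branch (s, n) y)) * indicator {1 / real n<..<1 / (real n - 1)} (branch (s, n) y)
        = g y * indicator {0<..<1} y"
      using branch_interval[of "(s, n)" y] branch_digit(2)[of "(s, n)" y] n
      by (cases "y \<in> {0<..<1}") simp_all
  qed
  also have "\<bar>c\<bar> = digit_prob n" using w n by (simp add: c_def digit_prob_def flip: w_def)
  finally show ?thesis by (simp add: nn_integral_unif)
qed

lemma nn_integral_digit_fibre_map:
  assumes [measurable]: "\<And>n. f n \<in> borel_measurable borel"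
  shows "(\<integral>\<^sup>+x. f (digit x) (fibre_map s x) \<partial>unif) = (\<integral>\<^sup>+n. (\<integral>\<^sup>+y. f n y \<partial>unif) \<partial>digit_pmf)"
proof -
  define G where "G n x = (if 2 \<le> n then f n (fibre_map s x) * indicator {1 / real n<..<1 / (real n - 1)} x else 0)"
    for n x
  have [measurable]: "G n \<in> borel_measurable borel" for n
    unfolding G_def by (cases "2 \<le> n") simp_all
  have meas [measurable]: "(\<lambda>x. f (digit x) (fibre_map s x)) \<in> borel_measurable borel"
    by (rule measurable_compose_countable) measurable
  \<comment> \<open>The end points 1/n are rational, so an irrational point of (0,1) lies in exactly
    one open digit interval and exactly one summand survives.\<close>
  have eq: "f (digit x) (fibre_map s x) * indicator {0<..<1} x = (\<Sum>n. G n x)" if "x \<notin> \<rat>" for x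
  proof (cases "x \<in> {0<..<1}")
    case True
    then have d: "2 \<le> digit x" "1 / real (digit x) \<le> x" "x < 1 / (real (digit x) - 1)"
      using digit_bounds[of x] by auto
    moreover have "1 / real (digit x) \<noteq> x" using that by (metis Rats_divide Rats_1 Rats_of_nat)
    ultimately have "G (digit x) x = f (digit x) (fibre_map s x)"
      by (simp add: G_def)
    moreover have "G n x = 0" if "n \<noteq> digit x" for n
      using digit_in_interval(1)[of n x] that by (auto simp: G_def split: split_indicator)
    ultimately show ?thesis
      using True by (subst suminf_finite[of "{digit x}"]) auto
  next
    case False
    then have "G n x = 0" for n using digit_in_interval(2,3)[of n x] by (auto simp: G_def split: split_indicator)
    then show ?thesis using False by simp
  qed
  have "(\<integral>\<^sup>+x. f (digit x) (fibre_map s x) \<partial>unif)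
      = (\<integral>\<^sup>+x. f (digit x) (fibre_map s x) * indicator {0<..<1} x \<partial>lborel)"
    by (rule nn_integral_unif) fact
  also have "\<dots> = (\<integral>\<^sup>+x. (\<Sum>n. G n x) \<partial>lborel)"
    using AE_irrational by (intro nn_integral_cong_AE) (auto simp: eq elim!: eventually_mono)
  also have "\<dots> = (\<Sum>n. \<integral>\<^sup>+x. G n x \<partial>lborel)"
    by (rule nn_integral_suminf) simp
  also have "\<dots> = (\<Sum>n. ennreal (digit_prob n) * (\<integral>\<^sup>+y. f n y \<partial>unif))"
    by (intro suminf_cong) (auto simp: G_def nn_integral_cylinder digit_prob_def)
  also have "\<dots> = (\<integral>\<^sup>+n. (\<integral>\<^sup>+y. f n y \<partial>unif) \<partial>digit_pmf)"
    by (simp add: nn_integral_measure_pmf nn_integral_count_space_nat)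
  finally show ?thesis .
qed

section \<open>One step of the skew product\<close>

definition first :: "bool stream \<times> real \<Rightarrow> bool \<times> nat" where
  "first z = (shd (fst z), digit (snd z))"

abbreviation skew :: "real \<Rightarrow> (bool stream \<times> real) measure" where
  "skew p \<equiv> bernoulli_measure p \<Otimes>\<^sub>M unif"

abbreviation letter_pmf :: "real \<Rightarrow> (bool \<times> nat) pmf" where
  "letter_pmf p \<equiv> pair_pmf (bernoulli_pmf (1 - p)) digit_pmf"

lemma sets_bernoulli_measure [measurable_cong, simp]:
  "sets (bernoulli_measure p) = sets (stream_space (count_space UNIV))"
  unfolding bernoulli_measure_def by (intro sets_stream_space_cong) simp

lemma space_bernoulli_measure [simp]: "space (bernoulli_measure p) = UNIV"
  by (simp add: bernoulli_measure_def space_stream_space)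

lemma prob_space_bernoulli: "prob_space (bernoulli_measure p)"
  unfolding bernoulli_measure_def
  by (intro prob_space.prob_space_stream_space measure_pmf.prob_space_axioms)

lemma prob_space_skew: "prob_space (skew p)"
  by (intro prob_space_pair prob_space_bernoulli prob_space_unif)

lemma measurable_first [measurable]: "first \<in> skew p \<rightarrow>\<^sub>M count_space UNIV"
proof -
  have "(\<lambda>z. (\<lambda>s z. (s, digit (snd z))) (shd (fst z)) z) \<in> skew p \<rightarrow>\<^sub>M count_space UNIV"
    by (rule measurable_compose_countable) measurable
  then show ?thesis by (simp add: first_def[abs_def])
qed

lemma measurable_random_luroth [measurable]: "random_luroth \<in> skew p \<rightarrow>\<^sub>M skew p"
proof -
  have "(\<lambda>z. (\<lambda>s z. fibre_map s (snd z)) (shd (fst z)) z) \<in> skew p \<rightarrow>\<^sub>M borel"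
    by (rule measurable_compose_countable) measurable
  then have [measurable]: "(\<lambda>z. fibre_map (shd (fst z)) (snd z)) \<in> skew p \<rightarrow>\<^sub>M unif" by simp
  show ?thesis unfolding random_luroth_def case_prod_beta by measurable
qed

text \<open>The letter that is read is independent of the next point, and the next point is again
  distributed according to the product measure.\<close>

lemma nn_integral_skew_step:
  assumes f: "f \<in> borel_measurable (count_space UNIV \<Otimes>\<^sub>M skew p)"
  shows "(\<integral>\<^sup>+z. f (first z, random_luroth z) \<partial>skew p) = (\<integral>\<^sup>+c. (\<integral>\<^sup>+z. f (c, z) \<partial>skew p) \<partial>letter_pmf p)"
proof -
  interpret B: prob_space "bernoulli_measure p" by (rule prob_space_bernoulli)
  interpret U: prob_space unif by (rule prob_space_unif)
  interpret S: prob_space "skew p" by (rule prob_space_skew)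
  interpret P: pair_sigma_finite "bernoulli_measure p" "measure_pmf digit_pmf" ..
  have [measurable]: "(\<lambda>z. f (first z, random_luroth z)) \<in> borel_measurable (skew p)"
    by (rule measurable_compose[OF _ f]) measurable
  have fsec: "(\<lambda>z. f (c, z)) \<in> borel_measurable (skew p)" for c
    by (rule measurable_compose[OF _ f]) measurable
  have "(\<integral>\<^sup>+z. f (first z, random_luroth z) \<partial>skew p)
      = (\<integral>\<^sup>+\<omega>. \<integral>\<^sup>+x. f (first (\<omega>, x), random_luroth (\<omega>, x)) \<partial>unif \<partial>bernoulli_measure p)"
    by (rule U.nn_integral_fst[symmetric]) measurable
  \<comment> \<open>A Bernoulli stream is a first symbol followed by an independent Bernoulli
    stream; this splits off the sign of the letter.\<close>
  also have "\<dots> = (\<integral>\<^sup>+s. \<integral>\<^sup>+\<omega>. \<integral>\<^sup>+x. f (first (s ## \<omega>, x), random_luroth (s ## \<omega>, x)) \<partial>unif \<partial>bernoulli_measure p \<partial>bernoulli_pmf (1 - p))"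
    unfolding bernoulli_measure_def
    by (rule prob_space.nn_integral_stream_space[OF measure_pmf.prob_space_axioms], fold bernoulli_measure_def)
       (rule U.borel_measurable_nn_integral, simp)
  also have "\<dots> = (\<integral>\<^sup>+s. \<integral>\<^sup>+\<omega>. \<integral>\<^sup>+n. \<integral>\<^sup>+y. f ((s, n), (\<omega>, y)) \<partial>unif \<partial>digit_pmf \<partial>bernoulli_measure p \<partial>bernoulli_pmf (1 - p))"
  proof (intro nn_integral_cong)
    fix s \<omega>
    have "(\<lambda>y. f ((s, n), (\<omega>, y))) \<in> borel_measurable borel" for n
      using measurable_compose[OF _ fsec[of "(s, n)"], of "\<lambda>y. (\<omega>, y)" borel] by simp
    then show "(\<integral>\<^sup>+x. f (first (s ## \<omega>, x), random_luroth (s ## \<omega>, x)) \<partial>unif)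
       = (\<integral>\<^sup>+n. \<integral>\<^sup>+y. f ((s, n), (\<omega>, y)) \<partial>unif \<partial>digit_pmf)"
      using nn_integral_digit_fibre_map[of "\<lambda>n y. f ((s, n), (\<omega>, y))" s]
      by (simp add: first_def random_luroth_def)
  qed
  \<comment> \<open>Moving the digit integral outside the stream integral brings sign and digit
    together as one letter.\<close>
  also have "\<dots> = (\<integral>\<^sup>+s. \<integral>\<^sup>+n. \<integral>\<^sup>+\<omega>. \<integral>\<^sup>+y. f ((s, n), (\<omega>, y)) \<partial>unif \<partial>bernoulli_measure p \<partial>digit_pmf \<partial>bernoulli_pmf (1 - p))"
  proof (rule nn_integral_cong)
    fix s :: bool
    have "(\<lambda>z. \<integral>\<^sup>+y. f ((s, snd z), (fst z, y)) \<partial>unif)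
        \<in> borel_measurable (bernoulli_measure p \<Otimes>\<^sub>M digit_pmf)"
    proof (rule measurable_compose_countable[where g = snd and f = "\<lambda>n z. \<integral>\<^sup>+y. f ((s, n), (fst z, y)) \<partial>unif"])
      fix n
      have "(\<lambda>\<omega>. \<integral>\<^sup>+y. f ((s, n), (\<omega>, y)) \<partial>unif) \<in> borel_measurable (bernoulli_measure p)"
        using U.borel_measurable_nn_integral[of "\<lambda>\<omega> y. f ((s, n), (\<omega>, y))" "bernoulli_measure p"] fsec[of "(s, n)"]
        by (simp add: case_prod_beta')
      then show "(\<lambda>z. \<integral>\<^sup>+y. f ((s, n), (fst z, y)) \<partial>unif) \<in> borel_measurable (bernoulli_measure p \<Otimes>\<^sub>M digit_pmf)"
        by measurable
    qed measurable
    then show "(\<integral>\<^sup>+\<omega>. \<integral>\<^sup>+n. \<integral>\<^sup>+y. f ((s, n), (\<omega>, y)) \<partial>unif \<partial>digit_pmf \<partial>bernoulli_measure p)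
      = (\<integral>\<^sup>+n. \<integral>\<^sup>+\<omega>. \<integral>\<^sup>+y. f ((s, n), (\<omega>, y)) \<partial>unif \<partial>bernoulli_measure p \<partial>digit_pmf)"
      using P.Fubini[of "\<lambda>(\<omega>, n). \<integral>\<^sup>+y. f ((s, n), (\<omega>, y)) \<partial>unif"] by (simp add: case_prod_beta')
  qed
  also have "\<dots> = (\<integral>\<^sup>+s. \<integral>\<^sup>+n. \<integral>\<^sup>+z. f ((s, n), z) \<partial>skew p \<partial>digit_pmf \<partial>bernoulli_pmf (1 - p))"
    by (intro nn_integral_cong) (rule U.nn_integral_fst[OF fsec])
  also have "\<dots> = (\<integral>\<^sup>+c. (\<integral>\<^sup>+z. f (c, z) \<partial>skew p) \<partial>letter_pmf p)"
    by (simp add: nn_integral_pair_pmf')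
  finally show ?thesis .
qed

text \<open>As an identity of measures, the independence also transfers integrability and integrals
  of real functions, where the signs of the values matter.\<close>

lemma distr_skew_step:
  "distr (skew p) (measure_pmf (letter_pmf p) \<Otimes>\<^sub>M skew p) (\<lambda>z. (first z, random_luroth z))
    = measure_pmf (letter_pmf p) \<Otimes>\<^sub>M skew p"
proof (rule measure_eqI)
  interpret S: prob_space "skew p" by (rule prob_space_skew)
  fix A assume "A \<in> sets (distr (skew p) (measure_pmf (letter_pmf p) \<Otimes>\<^sub>M skew p) (\<lambda>z. (first z, random_luroth z)))"
  then have A [measurable]: "A \<in> sets (measure_pmf (letter_pmf p) \<Otimes>\<^sub>M skew p)" by simp
  have s: "sets (measure_pmf (letter_pmf p) \<Otimes>\<^sub>M skew p) = sets (count_space UNIV \<Otimes>\<^sub>M skew p)"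
    by (intro sets_pair_measure_cong) auto
  have "emeasure (distr (skew p) (measure_pmf (letter_pmf p) \<Otimes>\<^sub>M skew p) (\<lambda>z. (first z, random_luroth z))) A
    = (\<integral>\<^sup>+z. indicator A z \<partial>distr (skew p) (measure_pmf (letter_pmf p) \<Otimes>\<^sub>M skew p) (\<lambda>z. (first z, random_luroth z)))"
    by simp
  also have "\<dots> = (\<integral>\<^sup>+z. indicator A (first z, random_luroth z) \<partial>skew p)"
    by (rule nn_integral_distr) measurable
  also have "\<dots> = (\<integral>\<^sup>+c. (\<integral>\<^sup>+z. indicator A (c, z) \<partial>skew p) \<partial>letter_pmf p)"
    using A s by (intro nn_integral_skew_step) simp
  also have "\<dots> = emeasure (measure_pmf (letter_pmf p) \<Otimes>\<^sub>M skew p) A"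
    by (rule S.emeasure_pair_measure[symmetric, OF A])
  finally show "emeasure (distr (skew p) (measure_pmf (letter_pmf p) \<Otimes>\<^sub>M skew p) (\<lambda>z. (first z, random_luroth z))) A
    = emeasure (measure_pmf (letter_pmf p) \<Otimes>\<^sub>M skew p) A" .
qed simp

section \<open>Averages along orbits\<close>

text \<open>One step is \<open>nn_integral_skew_step\<close> for functions of the next point alone:
  the letter integrates out with total mass 1.\<close>

lemma distr_random_luroth_funpow: "distr (skew p) (skew p) (random_luroth ^^ n) = skew p"
proof (induction n)
  case 0
  then show ?case by (simp add: distr_id2 id_def)
next
  case (Suc n)
  interpret S: prob_space "skew p" by (rule prob_space_skew)
  have 1: "distr (skew p) (skew p) random_luroth = skew p"
  proof (rule measure_eqI)
    fix A assume "A \<in> sets (distr (skew p) (skew p) random_luroth)"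
    then have [measurable]: "A \<in> sets (skew p)" by simp
    have "emeasure (distr (skew p) (skew p) random_luroth) A
        = (\<integral>\<^sup>+z. indicator A z \<partial>distr (skew p) (skew p) random_luroth)"
      by (rule nn_integral_indicator[symmetric]) (use \<open>A \<in> sets (skew p)\<close> in \<open>simp only: sets_distr\<close>)
    also have "\<dots> = (\<integral>\<^sup>+z. indicator A (random_luroth z) \<partial>skew p)"
      by (rule nn_integral_distr) measurable
    also have "\<dots> = (\<integral>\<^sup>+z. indicator A z \<partial>skew p)"
      using nn_integral_skew_step[of "\<lambda>u. indicator A (snd u)" p] by simp
    also have "\<dots> = emeasure (skew p) A" by (rule nn_integral_indicator) fact
    finally show "emeasure (distr (skew p) (skew p) random_luroth) A = emeasure (skew p) A" .
  qed simp
  have "distr (skew p) (skew p) (random_luroth ^^ Suc n)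
      = distr (distr (skew p) (skew p) (random_luroth ^^ n)) (skew p) random_luroth"
    by (subst distr_distr) (simp_all add: comp_def)
  then show ?case unfolding Suc 1 .
qed

text \<open>If \<open>\<phi>(c, z)\<close> averages to 0 over \<open>c\<close> for every \<open>z\<close>, the functions below are reverse martingale
  differences: conditionally on the later points each of them has mean 0.\<close>

theorem skew_strong_law:
  fixes \<phi> :: "(bool \<times> nat) \<times> (bool stream \<times> real) \<Rightarrow> real"
  assumes meas [measurable]: "\<phi> \<in> borel_measurable (measure_pmf (letter_pmf p) \<Otimes>\<^sub>M skew p)"
    and sq: "integrable (measure_pmf (letter_pmf p) \<Otimes>\<^sub>M skew p) (\<lambda>u. (\<phi> u)\<^sup>2)"
    and mean: "\<And>z. measure_pmf.expectation (letter_pmf p) (\<lambda>c. \<phi> (c, z)) = 0"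
  shows "AE z in skew p. (\<lambda>n. (\<Sum>i<n. \<phi> (first ((random_luroth ^^ i) z), (random_luroth ^^ Suc i) z)) / real n) \<longlonglongrightarrow> 0"
proof -
  let ?L = "measure_pmf (letter_pmf p)"
  let ?F = "random_luroth"
  interpret S: prob_space "skew p" by (rule prob_space_skew)
  interpret L: pair_prob_space ?L "skew p" ..
  define \<psi> where "\<psi> z = \<phi> (first z, ?F z)" for z
  have [measurable]: "\<psi> \<in> borel_measurable (skew p)" unfolding \<psi>_def by measurable
  have X: "\<phi> (first ((?F ^^ i) z), (?F ^^ Suc i) z) = \<psi> ((?F ^^ i) z)" for i z
    by (simp add: \<psi>_def)
  have step: "(\<integral>z. h (first z, ?F z) \<partial>skew p) = (\<integral>u. h u \<partial>(?L \<Otimes>\<^sub>M skew p))"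
    if [measurable]: "h \<in> borel_measurable (?L \<Otimes>\<^sub>M skew p)" for h :: "_ \<Rightarrow> real"
    by (subst distr_skew_step[symmetric], subst integral_distr) measurable
  have inv: "(\<integral>z. h ((?F ^^ i) z) \<partial>skew p) = (\<integral>z. h z \<partial>skew p)"
    if [measurable]: "h \<in> borel_measurable (skew p)" for h :: "_ \<Rightarrow> real" and i
    by (subst (2) distr_random_luroth_funpow[of p i, symmetric], subst integral_distr) measurable
  have sq\<psi>: "integrable (skew p) (\<lambda>z. (\<psi> z)\<^sup>2)"
  proof -
    have "integrable (distr (skew p) (?L \<Otimes>\<^sub>M skew p) (\<lambda>z. (first z, ?F z))) (\<lambda>u. (\<phi> u)\<^sup>2)"
      unfolding distr_skew_step by (rule sq)
    then show ?thesis unfolding \<psi>_def by (subst (asm) integrable_distr_eq) measurable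
  qed
  have sqi: "integrable (skew p) (\<lambda>z. (\<psi> ((?F ^^ i) z))\<^sup>2)" for i
  proof -
    have "integrable (distr (skew p) (skew p) (?F ^^ i)) (\<lambda>z. (\<psi> z)\<^sup>2)"
      unfolding distr_random_luroth_funpow by (rule sq\<psi>)
    then show ?thesis by (subst (asm) integrable_distr_eq) measurable
  qed
  \<comment> \<open>Invariance moves time i to time 0. The later factor is then a function of the
    next point, so integrating over the first letter annihilates the product.\<close>
  have orth: "(\<integral>z. \<psi> ((?F ^^ i) z) * \<psi> ((?F ^^ j) z) \<partial>skew p) = 0" if "i < j" for i j
  proof -
    obtain k where "j = Suc (i + k)" using less_imp_Suc_add[OF \<open>i < j\<close>] by blast
    then have k: "j = Suc k + i" by simp
    have iter: "random_luroth ^^ k \<in> skew p \<rightarrow>\<^sub>M skew p" by measurable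
    have [measurable]: "(\<lambda>z. (?F ^^ k) (?F z)) \<in> skew p \<rightarrow>\<^sub>M skew p"
      by (rule measurable_compose[OF measurable_random_luroth iter])
    have [measurable]: "(\<lambda>u. (?F ^^ k) (snd u)) \<in> (?L \<Otimes>\<^sub>M skew p) \<rightarrow>\<^sub>M skew p"
      by (rule measurable_compose[OF measurable_snd iter])
    have "(\<integral>z. \<psi> ((?F ^^ i) z) * \<psi> ((?F ^^ j) z) \<partial>skew p)
        = (\<integral>z. (\<lambda>z. \<psi> z * \<psi> ((?F ^^ k) (?F z))) ((?F ^^ i) z) \<partial>skew p)"
      by (simp only: k funpow_add comp_def funpow_Suc_right)
    also have "\<dots> = (\<integral>z. \<psi> z * \<psi> ((?F ^^ k) (?F z)) \<partial>skew p)"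
      by (rule inv) measurable
    also have "\<dots> = (\<integral>z. (\<lambda>u. \<phi> u * \<psi> ((?F ^^ k) (snd u))) (first z, ?F z) \<partial>skew p)"
      by (simp add: \<psi>_def)
    also have "\<dots> = (\<integral>u. \<phi> u * \<psi> ((?F ^^ k) (snd u)) \<partial>(?L \<Otimes>\<^sub>M skew p))"
      by (rule step) measurable
    also have "\<dots> = 0"
    \<comment> \<open>The Bochner integral of a non-integrable function is 0 by convention, so both
      cases give the same value.\<close>
    proof (cases "integrable (?L \<Otimes>\<^sub>M skew p) (\<lambda>u. \<phi> u * \<psi> ((?F ^^ k) (snd u)))")
      case True
      then have "(\<integral>u. \<phi> u * \<psi> ((?F ^^ k) (snd u)) \<partial>(?L \<Otimes>\<^sub>M skew p))
          = (\<integral>z. (\<integral>c. \<phi> (c, z) * \<psi> ((?F ^^ k) z) \<partial>?L) \<partial>skew p)"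
        using L.integral_snd[of "\<lambda>c z. \<phi> (c, z) * \<psi> ((?F ^^ k) z)"] by (simp add: case_prod_beta')
      then show ?thesis by (simp add: mean)
    qed (rule not_integrable_integral_eq)
    finally show ?thesis .
  qed
  show ?thesis unfolding X
    by (rule S.orthogonal_strong_law[where C = "\<integral>z. (\<psi> z)\<^sup>2 \<partial>skew p"])
       (use sqi orth inv[of "\<lambda>z. (\<psi> z)\<^sup>2"] in auto)
qed

section \<open>Expectations of functions of a digit\<close>

lemma integral_digit_pmf:
  fixes g :: "nat \<Rightarrow> real"
  assumes "summable (\<lambda>n. digit_prob n * \<bar>g n\<bar>)"
  shows "integrable digit_pmf g"
    and "(\<lambda>n. digit_prob n * g n) sums measure_pmf.expectation digit_pmf g"
proof -
  have i: "integrable (count_space UNIV) (\<lambda>n. digit_prob n * g n)"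
    using assms by (simp add: integrable_count_space_nat_iff abs_mult digit_prob_nonneg)
  then show "integrable digit_pmf g"
    by (simp add: measure_pmf_eq_density[of digit_pmf] integrable_density digit_prob_nonneg)
  show "(\<lambda>n. digit_prob n * g n) sums measure_pmf.expectation digit_pmf g"
    using sums_integral_count_space_nat[OF i]
    by (simp add: measure_pmf_eq_density[of digit_pmf] integral_density digit_prob_nonneg)
qed

text \<open>The indices 0 and 1 carry no mass. Nonnegativity starts at 2 because functions such as
  1/(n - 1) are negative at 0.\<close>

lemma expectation_digit_eqI:
  fixes g :: "nat \<Rightarrow> real"
  assumes "\<And>n. 2 \<le> n \<Longrightarrow> 0 \<le> g n"
    and "(\<lambda>n. digit_prob (n + 2) * g (n + 2)) sums a"
  shows "integrable digit_pmf g" "measure_pmf.expectation digit_pmf g = a"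
proof -
  have s: "(\<lambda>n. digit_prob n * g n) sums a"
    using assms(2) by (subst (asm) sums_iff_shift) (simp add: digit_prob_def numeral_2_eq_2)
  have "digit_prob n * \<bar>g n\<bar> = digit_prob n * g n" for n
    using assms(1)[of n] by (cases "2 \<le> n") (auto simp: digit_prob_def)
  then have "summable (\<lambda>n. digit_prob n * \<bar>g n\<bar>)" using s by (simp only: sums_iff)
  from integral_digit_pmf[OF this] s
  show "integrable digit_pmf g" "measure_pmf.expectation digit_pmf g = a"
    by (auto intro: sums_unique2)
qed

lemma zeta_2_sums: "(\<lambda>n. 1 / (real (Suc n))\<^sup>2) sums zeta 2"
proof -
  have "(\<lambda>n. 1 / real (Suc n) powr 2) = (\<lambda>n. 1 / (real (Suc n))\<^sup>2)"
    by (intro ext) (simp add: powr_numeral)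
  moreover have "summable (\<lambda>n. 1 / (real (Suc n))\<^sup>2)"
    using inverse_power_summable[of 2, where 'a = real]
    by (subst summable_Suc_iff) (simp add: inverse_eq_divide)
  ultimately show ?thesis unfolding zeta_def by (simp add: summable_sums)
qed

text \<open>With k = n - 1 the summand is 1/(k^2 (k + 1)) = 1/k^2 - (1/k - 1/(k + 1)): the squares
  give \<open>zeta 2\<close> and the rest telescopes to 1.\<close>

lemma expectation_inverse_pred_digit:
  "measure_pmf.expectation digit_pmf (\<lambda>n. 1 / (real n - 1)) = zeta 2 - 1"
proof (rule expectation_digit_eqI)
  have "digit_prob (n + 2) * (1 / (real (n + 2) - 1)) =
      1 / (real (Suc n))\<^sup>2 - (1 / real (Suc n) - 1 / real (Suc (Suc n)))" for n
    by (simp add: digit_prob_def divide_simps) (simp add: algebra_simps power2_eq_square)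
  then show "(\<lambda>n. digit_prob (n + 2) * (1 / (real (n + 2) - 1))) sums (zeta 2 - 1)"
    by (simp only:) (intro sums_diff zeta_2_sums telescope_inverse_sums)
qed auto

lemma expectation_inverse_digit:
  "measure_pmf.expectation digit_pmf (\<lambda>n. 1 / real n) = 2 - zeta 2"
proof (rule expectation_digit_eqI)
  have "digit_prob (n + 2) * (1 / real (n + 2)) =
      (1 / real (Suc n) - 1 / real (Suc (Suc n))) - 1 / (real (Suc (Suc n)))\<^sup>2" for n
    by (simp add: digit_prob_def divide_simps) (simp add: algebra_simps power2_eq_square)
  moreover have "(\<lambda>n. 1 / (real (Suc (Suc n)))\<^sup>2) sums (zeta 2 - 1)"
    using zeta_2_sums by (subst sums_Suc_iff) simp
  ultimately have "(\<lambda>n. digit_prob (n + 2) * (1 / real (n + 2))) sums (1 - (zeta 2 - 1))"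
    by (simp only:) (intro sums_diff telescope_inverse_sums)
  then show "(\<lambda>n. digit_prob (n + 2) * (1 / real (n + 2))) sums (2 - zeta 2)" by simp
qed auto

text \<open>The function is the midpoint of the interval of digit n. Weighted by the interval
  lengths, the midpoints add up to the integral of x over the unit interval; the proof telescopes
  half the differences of 1/k^2.\<close>

lemma expectation_branch_half:
  "integrable digit_pmf (\<lambda>n. (real n - 1 / 2) / (real n * (real n - 1)))"
  "measure_pmf.expectation digit_pmf (\<lambda>n. (real n - 1 / 2) / (real n * (real n - 1))) = 1 / 2"
proof -
  have "(\<lambda>n. 1 / (real (Suc n))\<^sup>2) \<longlonglongrightarrow> 0" by real_asymp
  then have "(\<lambda>n. 1 / (real (Suc n))\<^sup>2 - 1 / (real (Suc (Suc n)))\<^sup>2) sums (1 / (real (Suc 0))\<^sup>2 - 0)"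
    by (rule telescope_sums')
  then have "(\<lambda>n. (1 / 2) * (1 / (real (Suc n))\<^sup>2 - 1 / (real (Suc (Suc n)))\<^sup>2)) sums ((1 / 2) * 1)"
    by (intro sums_mult) simp
  then have "(\<lambda>n. (1 / 2) * (1 / (real (Suc n))\<^sup>2 - 1 / (real (Suc (Suc n)))\<^sup>2)) sums (1 / 2)"
    by simp
  moreover have "digit_prob (n + 2) * ((real (n + 2) - 1 / 2) / (real (n + 2) * (real (n + 2) - 1)))
      = (1 / 2) * (1 / (real (Suc n))\<^sup>2 - 1 / (real (Suc (Suc n)))\<^sup>2)" for n
    by (simp add: digit_prob_def divide_simps) (simp add: algebra_simps power2_eq_square)
  ultimately have s: "(\<lambda>n. digit_prob (n + 2) * ((real (n + 2) - 1 / 2) / (real (n + 2) * (real (n + 2) - 1)))) sums (1 / 2)"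
    by (simp only:)
  have nn: "0 \<le> (real n - 1 / 2) / (real n * (real n - 1))" if "2 \<le> n" for n
    using that by simp
  show "integrable digit_pmf (\<lambda>n. (real n - 1 / 2) / (real n * (real n - 1)))"
    "measure_pmf.expectation digit_pmf (\<lambda>n. (real n - 1 / 2) / (real n * (real n - 1))) = 1 / 2"
    using expectation_digit_eqI[OF nn s] by auto
qed

definition mean_log :: real where
  "mean_log = (\<Sum>\<^sub>\<infinity>d\<in>{2::nat..}. ln (real d * (real d - 1)) / (real d * (real d - 1)))"

text \<open>Logarithms grow more slowly than any power, so even the squared terms are O(n^(-3/2)).
  The second moment is what the strong law asks for.\<close>

lemma expectation_log_digit:
  shows "integrable digit_pmf (\<lambda>n. (ln (real n * (real n - 1)))\<^sup>2)"
    and "integrable digit_pmf (\<lambda>n. ln (real n * (real n - 1)))"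
    and "measure_pmf.expectation digit_pmf (\<lambda>n. ln (real n * (real n - 1))) = mean_log"
proof -
  have summ: "summable (\<lambda>n. digit_prob n * \<bar>g n\<bar>)"
    if "(\<lambda>n. \<bar>g n\<bar> / (real n * (real n - 1))) \<in> O(\<lambda>n. real n powr (- 3 / 2))" for g :: "nat \<Rightarrow> real"
  proof (rule summable_comparison_test_bigo)
    show "summable (\<lambda>n. norm (real n powr (- 3 / 2)))"
      by (simp add: summable_real_powr_iff)
    have "eventually (\<lambda>n. digit_prob n * \<bar>g n\<bar> = \<bar>g n\<bar> / (real n * (real n - 1))) sequentially"
      using eventually_ge_at_top[of 2] by eventually_elim (simp add: digit_prob_def)
    from landau_o.big.in_cong[OF this] that
    show "(\<lambda>n. digit_prob n * \<bar>g n\<bar>) \<in> O(\<lambda>n. real n powr (- 3 / 2))" by simp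
  qed
  have "(\<lambda>n. \<bar>(ln (real n * (real n - 1)))\<^sup>2\<bar> / (real n * (real n - 1))) \<in> O(\<lambda>n. real n powr (- 3 / 2))"
    by simp real_asymp
  from integral_digit_pmf(1)[OF summ[OF this]]
  show "integrable digit_pmf (\<lambda>n. (ln (real n * (real n - 1)))\<^sup>2)" by simp
  have s: "summable (\<lambda>n. digit_prob n * \<bar>ln (real n * (real n - 1))\<bar>)"
  proof (rule summ)
    show "(\<lambda>n. \<bar>ln (real n * (real n - 1))\<bar> / (real n * (real n - 1))) \<in> O(\<lambda>n. real n powr (- 3 / 2))"
      by real_asymp
  qed
  show "integrable digit_pmf (\<lambda>n. ln (real n * (real n - 1)))"
    by (rule integral_digit_pmf(1)[OF s])
  have "((\<lambda>n. digit_prob n * ln (real n * (real n - 1))) has_sum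
      measure_pmf.expectation digit_pmf (\<lambda>n. ln (real n * (real n - 1)))) UNIV"
    using s by (intro norm_summable_imp_has_sum integral_digit_pmf(2)[OF s])
      (simp add: abs_mult digit_prob_nonneg)
  then have "measure_pmf.expectation digit_pmf (\<lambda>n. ln (real n * (real n - 1)))
     = (\<Sum>\<^sub>\<infinity>n. digit_prob n * ln (real n * (real n - 1)))" by (simp add: infsumI)
  also have "\<dots> = mean_log"
    unfolding mean_log_def by (rule infsum_cong_neutral) (auto simp: digit_prob_def)
  finally show "measure_pmf.expectation digit_pmf (\<lambda>n. ln (real n * (real n - 1))) = mean_log" .
qed

section \<open>The rate at typical points\<close>

lemma integrable_letter_snd:
  fixes g :: "nat \<Rightarrow> real"
  shows "integrable (letter_pmf p) (\<lambda>c. g (snd c)) \<longleftrightarrow> integrable digit_pmf g"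
  using integrable_map_pmf_eq[of snd "letter_pmf p" g] by (simp only: map_snd_pair_pmf)

lemma AE_skew_regular: "AE z in skew p. 0 < snd z \<and> snd z < 1 \<and> snd z \<notin> \<rat>"
proof -
  interpret B: prob_space "bernoulli_measure p" by (rule prob_space_bernoulli)
  interpret U: prob_space unif by (rule prob_space_unif)
  interpret P: pair_sigma_finite "bernoulli_measure p" unif ..
  have "(\<rat> :: real set) \<in> sets borel" by (rule sets.countable[OF _ countable_rat]) auto
  then have [measurable]: "Measurable.pred borel (\<lambda>x::real. x \<in> \<rat>)" by (simp add: pred_def)
  have "AE z in skew p. (\<lambda>z. 0 < snd z \<and> snd z < 1 \<and> snd z \<notin> \<rat>) z"
    by (rule P.AE_pair_measure, measurable) (use AE_unif in simp)
  then show ?thesis by simp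
qed

lemma skew_iterates:
  "first ((random_luroth ^^ n) (\<omega>, x)) = expansion \<omega> x n"
  "snd ((random_luroth ^^ n) (\<omega>, x)) = orbit \<omega> n x"
  by (simp_all add: random_luroth_funpow first_def expansion_def)

lemma AE_mean_log:
  "AE z in skew p. (\<lambda>n. (\<Sum>i<n. ln (weight (expansion (fst z) (snd z) i))) / real n) \<longlonglongrightarrow> mean_log"
proof -
  interpret S: prob_space "skew p" by (rule prob_space_skew)
  interpret L: pair_prob_space "measure_pmf (letter_pmf p)" "skew p" ..
  have i: "integrable (letter_pmf p) (\<lambda>c. (ln (weight c))\<^sup>2)" "integrable (letter_pmf p) (\<lambda>c. ln (weight c))"
    unfolding weight_def
    by (rule integrable_letter_snd[THEN iffD2, OF expectation_log_digit(1)],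
        rule integrable_letter_snd[THEN iffD2, OF expectation_log_digit(2)])
  have E: "measure_pmf.expectation (letter_pmf p) (\<lambda>c. ln (weight c)) = mean_log"
    unfolding weight_def
    by (rule expectation_pair_pmf_snd[THEN trans, OF expectation_log_digit(3)])
  have "integrable (letter_pmf p) (\<lambda>c. (ln (weight c) - mean_log)\<^sup>2)"
    unfolding power2_diff using i
    by (intro Bochner_Integration.integrable_add Bochner_Integration.integrable_diff integrable_mult_left integrable_mult_right measure_pmf.integrable_const) auto
  then have "integrable (measure_pmf (letter_pmf p) \<Otimes>\<^sub>M skew p) (\<lambda>u. (ln (weight (fst u)) - mean_log)\<^sup>2)"
    by (subst (asm) S.distr_pair_fst[symmetric], subst (asm) integrable_distr_eq) simp_all
  then have "AE z in skew p. (\<lambda>n. (\<Sum>i<n. ln (weight (fst (first ((random_luroth ^^ i) z), (random_luroth ^^ Suc i) z))) - mean_log) / real n) \<longlonglongrightarrow> 0"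
    using i E by (intro skew_strong_law) simp_all
  then show ?thesis
  proof eventually_elim
    case (elim z)
    have "(\<lambda>n. (\<Sum>i<n. ln (weight (expansion (fst z) (snd z) i)) - mean_log) / real n) \<longlonglongrightarrow> 0"
      using elim skew_iterates(1)[of _ "fst z" "snd z"] by simp
    then have "(\<lambda>n. (\<Sum>i<n. ln (weight (expansion (fst z) (snd z) i)) - mean_log) / real n + mean_log) \<longlonglongrightarrow> 0 + mean_log"
      by (intro tendsto_intros)
    moreover have "eventually (\<lambda>n. (\<Sum>i<n. ln (weight (expansion (fst z) (snd z) i)) - mean_log) / real n + mean_log
       = (\<Sum>i<n. ln (weight (expansion (fst z) (snd z) i))) / real n) sequentially"
      using eventually_gt_at_top[of 0]
      by eventually_elim (simp add: sum_subtractf field_simps)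
    ultimately show ?case by (auto intro: Lim_transform_eventually)
  qed
qed

text \<open>By \<open>ln_convergent_error\<close> only ln (v n)/n has to vanish. From 1/weight <= v
  n <= 1 its modulus is at most ln (weight (e n))/n, and this tends to 0 as the difference of
  consecutive averages, up to the factor (n + 1)/n.\<close>

lemma rate_of_mean_log:
  assumes e: "admissible e" and v: "tails e v"
    and lim: "(\<lambda>n. (\<Sum>i<n. ln (weight (e i))) / real n) \<longlonglongrightarrow> m"
  shows "converges_at_rate e (v 0) (- m)"
proof -
  define S where "S n = (\<Sum>i<n. ln (weight (e i)))" for n
  have lim: "(\<lambda>n. S n / real n) \<longlonglongrightarrow> m" using lim by (simp add: S_def)
  have "(\<lambda>n. S (Suc n) / real (Suc n) * (real (Suc n) / real n) - S n / real n) \<longlonglongrightarrow> m * 1 - m"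
  proof (intro tendsto_diff tendsto_mult lim LIMSEQ_Suc[OF lim])
    show "(\<lambda>n. real (Suc n) / real n) \<longlonglongrightarrow> 1" by real_asymp
  qed
  moreover have "S (Suc n) / real (Suc n) * (real (Suc n) / real n) - S n / real n = ln (weight (e n)) / real n" for n
  proof -
    have "S (Suc n) / real (Suc n) * (real (Suc n) / real n) = S (Suc n) / real n"
      by (simp del: of_nat_Suc)
    also have "\<dots> = (S n + ln (weight (e n))) / real n" by (simp add: S_def)
    finally show ?thesis by (simp add: add_divide_distrib)
  qed
  ultimately have w: "(\<lambda>n. ln (weight (e n)) / real n) \<longlonglongrightarrow> 0" by simp
  have bd: "\<bar>ln (v n)\<bar> \<le> ln (weight (e n))" for n
  proof -
    have d: "2 \<le> snd (e n)" using e by (simp add: admissible_def)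
    have "1 / weight (e n) \<le> 1 / real (snd (e n))"
      using d by (intro frac_le) (auto simp: weight_def)
    also have "\<dots> \<le> branch (e n) (v (Suc n))"
      using tails_pos[OF v, of "Suc n"] d by (intro branch_pos) auto
    also have "\<dots> = v n" using v unfolding tails_def by metis
    finally have "1 / weight (e n) \<le> v n" .
    moreover have "0 < weight (e n)" using weight_ge_2[OF d] by simp
    ultimately have "ln (1 / weight (e n)) \<le> ln (v n)" by (subst ln_le_cancel_iff) (use tails_pos[OF v] in auto)
    moreover have "ln (v n) \<le> 0" using tails_pos[OF v, of n] by simp
    ultimately show ?thesis using \<open>0 < weight (e n)\<close> by (simp add: ln_div)
  qed
  have "(\<lambda>n. ln (v n) / real n) \<longlonglongrightarrow> 0"
    by (rule Lim_null_comparison[OF _ w]) (use bd in \<open>auto intro!: always_eventually divide_right_mono\<close>)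
  then have "(\<lambda>n. ln (v n) / real n - S n / real n) \<longlonglongrightarrow> 0 - m"
    by (intro tendsto_diff lim)
  then show ?thesis
    unfolding converges_at_rate_def ln_convergent_error[OF e v] S_def
    by (simp add: diff_divide_distrib)
qed

lemma AE_rate:
  "AE z in skew p. converges_at_rate (expansion (fst z) (snd z)) (snd z) (- mean_log)"
  using AE_mean_log[of p] AE_skew_regular[of p]
proof eventually_elim
  case (elim z)
  have "snd z = orbit (fst z) 0 (snd z)" by simp
  then show ?case
    using rate_of_mean_log[OF expansion_admissible expansion_tails elim(1)] elim(2) by auto
qed

section \<open>Averages of the approximation coefficients\<close>

definition letter_coeff :: "bool \<times> nat \<Rightarrow> real" where
  "letter_coeff c = (real (snd c) - of_bool (fst c)) / weight c"

lemma letter_coeff_eq: "letter_coeff (s, d) = (if s then 1 / real d else 1 / (real d - 1))" if "2 \<le> d"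
  using that by (simp add: letter_coeff_def weight_def)

text \<open>For the digits 0 and 1 the weight is 0 and division by zero gives 0, so the bound holds
  on all letters, as \<open>skew_strong_law_bounded\<close> demands.\<close>

lemma letter_coeff_bounds: "0 \<le> letter_coeff c \<and> letter_coeff c \<le> 1"
proof (cases "2 \<le> snd c")
  case True
  then show ?thesis using letter_coeff_eq[of "snd c" "fst c"] by auto
next
  case False
  then have "snd c = 0 \<or> snd c = 1" by auto
  then show ?thesis by (auto simp: letter_coeff_def weight_def)
qed

lemma bounded_branch:
  assumes "0 \<le> y" "y \<le> 1"
  shows "0 \<le> branch c y \<and> branch c y \<le> 1"
proof (cases "2 \<le> snd c")
  case True
  have "0 < weight c" using weight_ge_2[OF True] by simp
  moreover have "real (snd c) * 1 \<le> weight c" unfolding weight_def using True by (intro mult_left_mono) auto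
  ultimately show ?thesis using assms True by (auto simp: branch_def divide_le_eq)
next
  case False
  then have "snd c = 0 \<or> snd c = 1" by auto
  then show ?thesis by (auto simp: branch_def weight_def)
qed

definition slope :: "bool \<times> nat \<Rightarrow> real" where
  "slope c = (if fst c then -1 else 1) / weight c"

lemma slope_bound: "\<bar>slope c\<bar> \<le> 1 / 2"
proof (cases "2 \<le> snd c")
  case True
  then show ?thesis using weight_ge_2[OF True] by (simp add: slope_def abs_divide divide_simps)
next
  case False
  then have "snd c = 0 \<or> snd c = 1" by auto
  then show ?thesis by (auto simp: slope_def weight_def)
qed

text \<open>Around \<open>1/2\<close> the constant terms average to \<open>1/2\<close> by telescoping, so that the conditional mean of
  \<open>T\<^sup>n x - 1/2\<close> given the next point is a fixed multiple of \<open>T\<^bsup>n+1\<^esup> x - 1/2\<close>.\<close>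

lemma branch_slope: "branch c y = (real (snd c) - 1 / 2) / (real (snd c) * (real (snd c) - 1)) + slope c * (y - 1 / 2)"
  by (simp add: branch_def slope_def weight_def diff_divide_distrib[symmetric] add_divide_distrib[symmetric])

definition mean_slope :: "real \<Rightarrow> real" where
  "mean_slope p = measure_pmf.expectation (letter_pmf p) slope"

definition mean_coeff :: "real \<Rightarrow> real" where
  "mean_coeff p = measure_pmf.expectation (letter_pmf p) letter_coeff"

lemma integrable_slope: "integrable (letter_pmf p) slope"
  by (rule measure_pmf.integrable_const_bound[where B = "1/2"], rule AE_I2)
     (simp_all only: real_norm_def slope_bound, simp)

lemma integrable_coeff: "integrable (letter_pmf p) letter_coeff"
  by (rule measure_pmf.integrable_const_bound[where B = 1]) (use letter_coeff_bounds in auto)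

text \<open>Allows division by 1 - \<open>mean_slope p\<close> when solving for the average of the
  orbit.\<close>

lemma mean_slope_less_1: "mean_slope p < 1"
proof -
  have "mean_slope p \<le> measure_pmf.expectation (letter_pmf p) (\<lambda>_. 1 / 2)"
    unfolding mean_slope_def
    by (intro integral_mono integrable_slope order_trans[OF abs_ge_self slope_bound]) simp
  then show ?thesis by simp
qed

lemma expectation_branch:
  "measure_pmf.expectation (letter_pmf p) (\<lambda>c. branch c y) = 1 / 2 + mean_slope p * (y - 1 / 2)"
proof -
  let ?g = "\<lambda>n. (real n - 1 / 2) / (real n * (real n - 1))"
  have "integrable (letter_pmf p) (\<lambda>c. ?g (snd c))"
    by (rule integrable_letter_snd[THEN iffD2, OF expectation_branch_half(1)])
  moreover have "measure_pmf.expectation (letter_pmf p) (\<lambda>c. ?g (snd c)) = 1 / 2"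
    by (rule expectation_pair_pmf_snd[THEN trans, OF expectation_branch_half(2)])
  ultimately show ?thesis
    unfolding branch_slope mean_slope_def using integrable_slope[of p]
    by (subst Bochner_Integration.integral_add) auto
qed

lemma mean_coeff:
  assumes "0 \<le> p" "p \<le> 1"
  shows "mean_coeff p = p * (zeta 2 - 1) + (1 - p) * (2 - zeta 2)"
proof -
  have AE2: "AE n in digit_pmf. 2 \<le> n"
    by (auto simp: AE_measure_pmf_iff set_pmf_eq digit_prob_def split: if_splits)
  have F: "(\<integral>\<^sup>+n. ennreal (letter_coeff (s, n)) \<partial>digit_pmf) = ennreal a"
    if "measure_pmf.expectation digit_pmf (\<lambda>n. letter_coeff (s, n)) = a" for s a
    using that letter_coeff_bounds
    by (subst nn_integral_eq_integral)
       (auto intro: measure_pmf.integrable_const_bound[where B = 1])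
  have f: "measure_pmf.expectation digit_pmf (\<lambda>n. letter_coeff (False, n)) = zeta 2 - 1"
    unfolding expectation_inverse_pred_digit[symmetric]
    by (rule integral_cong_AE) (use AE2 in \<open>auto simp: letter_coeff_eq elim!: eventually_mono\<close>)
  have t: "measure_pmf.expectation digit_pmf (\<lambda>n. letter_coeff (True, n)) = 2 - zeta 2"
    unfolding expectation_inverse_digit[symmetric]
    by (rule integral_cong_AE) (use AE2 in \<open>auto simp: letter_coeff_eq elim!: eventually_mono\<close>)
  have nn: "0 \<le> zeta 2 - 1" "0 \<le> 2 - zeta 2"
    unfolding f[symmetric] t[symmetric] using letter_coeff_bounds by (auto intro!: integral_nonneg_AE)
  \<comment> \<open>Sign and digit are integrated one after the other as nonnegative integrals;
    \<open>nn\<close> then permits the return to real numbers.\<close>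
  have "ennreal (mean_coeff p) = (\<integral>\<^sup>+c. ennreal (letter_coeff c) \<partial>letter_pmf p)"
    unfolding mean_coeff_def using letter_coeff_bounds
    by (intro nn_integral_eq_integral[symmetric] integrable_coeff) auto
  also have "\<dots> = ennreal (2 - zeta 2) * ennreal (1 - p) + ennreal (zeta 2 - 1) * ennreal (1 - (1 - p))"
    using assms by (simp add: nn_integral_pair_pmf' F[OF f] F[OF t])
  also have "\<dots> = ennreal ((2 - zeta 2) * (1 - p) + (zeta 2 - 1) * p)"
    using assms nn by (simp add: ennreal_mult ennreal_plus)
  finally have "mean_coeff p = (2 - zeta 2) * (1 - p) + (zeta 2 - 1) * p"
    using assms nn letter_coeff_bounds
    by (subst (asm) ennreal_inj) (auto simp: mean_coeff_def intro!: integral_nonneg_AE)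
  then show ?thesis by simp
qed

lemma skew_strong_law_bounded:
  fixes f :: "(bool \<times> nat) \<Rightarrow> real \<Rightarrow> real"
  assumes meas: "\<And>c. f c \<in> borel_measurable borel" and bd: "\<And>c y. 0 \<le> y \<Longrightarrow> y \<le> 1 \<Longrightarrow> \<bar>f c y\<bar> \<le> K"
    and mean: "\<And>y. 0 \<le> y \<Longrightarrow> y \<le> 1 \<Longrightarrow> measure_pmf.expectation (letter_pmf p) (\<lambda>c. f c y) = 0"
  shows "AE z in skew p. (\<lambda>n. (\<Sum>i<n. f (expansion (fst z) (snd z) i) (orbit (fst z) (Suc i) (snd z))) / real n) \<longlonglongrightarrow> 0"
proof -
  interpret S: prob_space "skew p" by (rule prob_space_skew)
  interpret L: pair_prob_space "measure_pmf (letter_pmf p)" "skew p" ..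
  \<comment> \<open>\<open>unif\<close> lives on the whole real line, while the bounds and means of
    f are known on [0,1] only. Clipping the point supplies them everywhere and changes nothing along
    almost every orbit.\<close>
  define \<phi> where "\<phi> u = f (fst u) (max 0 (min 1 (snd (snd u))))" for u :: "(bool \<times> nat) \<times> (bool stream \<times> real)"
  have [measurable]: "\<phi> \<in> borel_measurable (measure_pmf (letter_pmf p) \<Otimes>\<^sub>M skew p)"
    unfolding \<phi>_def[abs_def]
  proof (rule measurable_compose_countable[where g = fst])
    fix c
    have "(\<lambda>u. max 0 (min 1 (snd (snd u)))) \<in> borel_measurable (measure_pmf (letter_pmf p) \<Otimes>\<^sub>M skew p)"
      by measurable
    then show "(\<lambda>u. f c (max 0 (min 1 (snd (snd u))))) \<in> borel_measurable (measure_pmf (letter_pmf p) \<Otimes>\<^sub>M skew p)"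
      by (rule measurable_compose[OF _ meas])
  qed measurable
  have K: "\<bar>\<phi> u\<bar> \<le> K" for u unfolding \<phi>_def by (rule bd) auto
  have "\<bar>(\<phi> u)\<^sup>2\<bar> \<le> K\<^sup>2" for u
    using power_mono[OF K abs_ge_zero, of u 2] by simp
  then have "integrable (measure_pmf (letter_pmf p) \<Otimes>\<^sub>M skew p) (\<lambda>u. (\<phi> u)\<^sup>2)"
    by (intro L.integrable_const_bound[where B = "K\<^sup>2"]) auto
  then have "AE z in skew p. (\<lambda>n. (\<Sum>i<n. \<phi> (first ((random_luroth ^^ i) z), (random_luroth ^^ Suc i) z)) / real n) \<longlonglongrightarrow> 0"
    by (rule skew_strong_law[rotated]) (simp add: \<phi>_def mean, fact)
  with AE_skew_regular[of p] show ?thesis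
  proof eventually_elim
    case (elim z)
    have "\<phi> (first ((random_luroth ^^ i) z), (random_luroth ^^ Suc i) z)
       = f (expansion (fst z) (snd z) i) (orbit (fst z) (Suc i) (snd z))" for i
      using skew_iterates[of _ "fst z" "snd z"] orbit_in[of "snd z" "fst z" "Suc i"] elim(1)
      unfolding \<phi>_def by (simp del: funpow.simps orbit.simps)
    then show ?case using elim(2) by (simp only:)
  qed
qed

text \<open>Split c i * y (i + 1) into (c i - a) * y (i + 1), a * (y (i + 1) - 1/2) and a/2. The
  first part averages to 0 by A. For the second, the sum in B telescopes to 1 - \<kappa> times the
  centred sum \<open>t\<close>, up to the bounded boundary term y 0 - y n.\<close>

lemma averages_of_products:
  fixes c y :: "nat \<Rightarrow> real"
  assumes y: "\<And>n. \<bar>y n\<bar> \<le> 1" and "\<kappa> < 1"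
    and A: "(\<lambda>n. (\<Sum>i<n. (c i - a) * y (Suc i)) / real n) \<longlonglongrightarrow> 0"
    and B: "(\<lambda>n. (\<Sum>i<n. y i - 1 / 2 - \<kappa> * (y (Suc i) - 1 / 2)) / real n) \<longlonglongrightarrow> 0"
  shows "(\<lambda>n. (\<Sum>i<n. c i * y (Suc i)) / real n) \<longlonglongrightarrow> a / 2"
proof -
  define b where "b n = (\<Sum>i<n. y i - 1 / 2 - \<kappa> * (y (Suc i) - 1 / 2))" for n
  define t where "t n = (\<Sum>i<n. y (Suc i) - 1 / 2)" for n
  have bt: "b n = (1 - \<kappa>) * t n + y 0 - y n" for n
  proof (induction n)
    case (Suc n)
    have b: "b (Suc n) = b n + (y n - 1 / 2 - \<kappa> * (y (Suc n) - 1 / 2))"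
      and t: "t (Suc n) = t n + (y (Suc n) - 1 / 2)"
      by (simp_all add: b_def t_def)
    show ?case using Suc unfolding b t by (simp add: field_simps)
  qed (simp add: b_def t_def)
  have "(\<lambda>n. (y n - y 0) / real n) \<longlonglongrightarrow> 0"
  proof (rule Lim_null_comparison)
    show "(\<lambda>n. 2 / real n) \<longlonglongrightarrow> 0" by real_asymp
    have "\<bar>y n - y 0\<bar> \<le> 2" for n using y[of n] y[of 0] by linarith
    then show "eventually (\<lambda>n. norm ((y n - y 0) / real n) \<le> 2 / real n) sequentially"
      by (auto intro!: always_eventually divide_right_mono)
  qed
  with B have "(\<lambda>n. (b n / real n + (y n - y 0) / real n) / (1 - \<kappa>)) \<longlonglongrightarrow> (0 + 0) / (1 - \<kappa>)"
    unfolding b_def using \<open>\<kappa> < 1\<close> by (intro tendsto_intros) auto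
  moreover have "(b n / real n + (y n - y 0) / real n) / (1 - \<kappa>) = t n / real n" for n
    unfolding bt using \<open>\<kappa> < 1\<close> by (simp add: add_divide_distrib diff_divide_distrib)
  ultimately have t: "(\<lambda>n. t n / real n) \<longlonglongrightarrow> 0" by simp
  have "(\<lambda>n. (\<Sum>i<n. (c i - a) * y (Suc i)) / real n + a * (t n / real n) + a / 2) \<longlonglongrightarrow> 0 + a * 0 + a / 2"
    by (intro tendsto_intros A t)
  moreover have "eventually (\<lambda>n. (\<Sum>i<n. (c i - a) * y (Suc i)) / real n + a * (t n / real n) + a / 2
      = (\<Sum>i<n. c i * y (Suc i)) / real n) sequentially"
    using eventually_gt_at_top[of 0]
  proof eventually_elim
    case (elim n)
    have "(\<Sum>i<n. c i * y (Suc i)) = (\<Sum>i<n. (c i - a) * y (Suc i)) + a * t n + a / 2 * real n"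
      unfolding t_def by (induction n) (simp_all add: algebra_simps)
    then show ?case using elim by (simp add: add_divide_distrib)
  qed
  ultimately show ?thesis by (simp add: tendsto_cong)
qed

lemma AE_approx_coeff:
  assumes "0 \<le> p" "p \<le> 1"
  shows "AE z in skew p. (\<lambda>n. 1 / real n * (\<Sum>i = 1..n. approx_coeff (fst z) (snd z) i))
    \<longlonglongrightarrow> p * ((2 * zeta 2 - 3) / 2) + (2 - zeta 2) / 2"
proof -
  have A: "AE z in skew p. (\<lambda>n. (\<Sum>i<n. (letter_coeff (expansion (fst z) (snd z) i) - mean_coeff p) * orbit (fst z) (Suc i) (snd z)) / real n) \<longlonglongrightarrow> 0"
  proof (rule skew_strong_law_bounded)
    fix c and y :: real assume y: "0 \<le> y" "y \<le> 1"
    have "\<bar>(letter_coeff c - mean_coeff p) * y\<bar> \<le> (1 + \<bar>mean_coeff p\<bar>) * 1"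
      unfolding abs_mult using y letter_coeff_bounds[of c] by (intro mult_mono) auto
    then show "\<bar>(letter_coeff c - mean_coeff p) * y\<bar> \<le> 1 + \<bar>mean_coeff p\<bar>" by simp
    show "measure_pmf.expectation (letter_pmf p) (\<lambda>c. (letter_coeff c - mean_coeff p) * y) = 0"
      using integrable_coeff[of p] by (simp add: mean_coeff_def)
  qed simp
  \<comment> \<open>The branch of the letter at the next point is the current orbit point, so this
    is the centred relation between consecutive orbit points.\<close>
  have B: "AE z in skew p. (\<lambda>n. (\<Sum>i<n. branch (expansion (fst z) (snd z) i) (orbit (fst z) (Suc i) (snd z)) - 1 / 2
      - mean_slope p * (orbit (fst z) (Suc i) (snd z) - 1 / 2)) / real n) \<longlonglongrightarrow> 0"
  proof (rule skew_strong_law_bounded)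
    fix c and y :: real assume y: "0 \<le> y" "y \<le> 1"
    have "\<bar>mean_slope p * (y - 1 / 2)\<bar> \<le> \<bar>mean_slope p\<bar> * 1"
      unfolding abs_mult using y by (intro mult_left_mono) (auto simp: abs_le_iff)
    then show "\<bar>branch c y - 1 / 2 - mean_slope p * (y - 1 / 2)\<bar> \<le> 1 + \<bar>mean_slope p\<bar>"
      using bounded_branch[OF y, of c] by linarith
    have "integrable (letter_pmf p) (\<lambda>c. branch c y)"
      by (rule measure_pmf.integrable_const_bound[where B = 1]) (use bounded_branch[OF y] in auto)
    then show "measure_pmf.expectation (letter_pmf p) (\<lambda>c. branch c y - 1 / 2 - mean_slope p * (y - 1 / 2)) = 0"
      by (simp add: expectation_branch)
  qed (simp add: branch_def)
  show ?thesis using A B AE_skew_regular[of p]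
  proof eventually_elim
    case (elim z)
    let ?y = "\<lambda>n. orbit (fst z) n (snd z)" and ?e = "expansion (fst z) (snd z)"
    have z: "0 < snd z" "snd z \<le> 1" "snd z \<notin> \<rat>" using elim(3) by auto
    have br: "branch (?e i) (?y (Suc i)) = ?y i" for i by (rule branch_orbit[OF z])
    have "(\<lambda>n. (\<Sum>i<n. letter_coeff (?e i) * ?y (Suc i)) / real n) \<longlonglongrightarrow> mean_coeff p / 2"
    proof (rule averages_of_products[OF _ mean_slope_less_1 elim(1)])
      show "\<bar>?y n\<bar> \<le> 1" for n using orbit_in[OF z(1,2), of "fst z" n] by simp
      show "(\<lambda>n. (\<Sum>i<n. ?y i - 1 / 2 - mean_slope p * (?y (Suc i) - 1 / 2)) / real n) \<longlonglongrightarrow> 0"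
        using elim(2) unfolding br .
    qed
    moreover have "1 / real n * (\<Sum>i = 1..n. approx_coeff (fst z) (snd z) i) = (\<Sum>i<n. letter_coeff (?e i) * ?y (Suc i)) / real n" for n
      by (simp add: sum.atLeast1_atMost_eq approx_coeff_Suc[OF z] letter_coeff_def del: orbit.simps)
    moreover have "mean_coeff p / 2 = p * ((2 * zeta 2 - 3) / 2) + (2 - zeta 2) / 2"
      unfolding mean_coeff[OF assms] by (simp add: field_simps)
    ultimately show ?case by (simp only:)
  qed
qed

section \<open>Universal expansions\<close>

definition reads :: "(bool \<times> nat) list \<Rightarrow> bool stream \<times> real \<Rightarrow> bool" where
  "reads b z \<longleftrightarrow> (\<forall>j<length b. first ((random_luroth ^^ j) z) = b ! j)"

lemma reads_Cons: "reads (c # b) z \<longleftrightarrow> first z = c \<and> reads b (random_luroth z)"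
  unfolding reads_def by (auto simp: All_less_Suc2 funpow_swap1)

lemma reads_sets: "{z. reads b z} \<in> sets (skew p)"
proof -
  have "(\<lambda>z. first ((random_luroth ^^ j) z)) \<in> skew p \<rightarrow>\<^sub>M count_space UNIV" for j
    by (rule measurable_compose[OF _ measurable_first]) measurable
  then have "{z\<in>space (skew p). \<forall>j<length b. first ((random_luroth ^^ j) z) = b ! j} \<in> sets (skew p)"
    by measurable
  then show ?thesis by (simp add: reads_def space_pair_measure)
qed

text \<open>Each letter read is independent of the point reached afterwards, so the probabilities of
  the letters factor out one by one.\<close>

lemma emeasure_reads:
  assumes S: "S \<in> sets (skew p)"
  shows "emeasure (skew p) {z. reads b z \<and> (random_luroth ^^ length b) z \<in> S}
    = (\<Prod>c\<leftarrow>b. ennreal (pmf (letter_pmf p) c)) * emeasure (skew p) S"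
proof (induction b)
  case Nil
  then show ?case by (simp add: reads_def)
next
  case (Cons c b)
  define R where "R = {z. reads b z \<and> (random_luroth ^^ length b) z \<in> S}"
  have "(random_luroth ^^ length b) -` S \<inter> space (skew p) \<in> sets (skew p)"
    by (rule measurable_sets[OF _ S]) measurable
  then have "{z. reads b z} \<inter> ((random_luroth ^^ length b) -` S) \<in> sets (skew p)"
    using reads_sets[of b p] by (intro sets.Int) (auto simp: space_pair_measure)
  then have R: "R \<in> sets (skew p)" by (simp add: R_def Int_def)
  have eq: "{z. reads (c # b) z \<and> (random_luroth ^^ length (c # b)) z \<in> S} = {z. first z = c \<and> random_luroth z \<in> R}"
    by (auto simp: reads_Cons R_def funpow_swap1)
  have Z: "{z. first z = c \<and> random_luroth z \<in> R} \<in> sets (skew p)"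
  proof -
    have "{z\<in>space (skew p). first z = c \<and> random_luroth z \<in> R} \<in> sets (skew p)"
      using R by measurable
    then show ?thesis by (simp add: space_pair_measure)
  qed
  have "emeasure (skew p) {z. first z = c \<and> random_luroth z \<in> R}
      = (\<integral>\<^sup>+z. indicator {z. first z = c \<and> random_luroth z \<in> R} z \<partial>skew p)"
    by (rule nn_integral_indicator[symmetric, OF Z])
  also have "\<dots> = (\<integral>\<^sup>+z. (\<lambda>u. indicator {c} (fst u) * indicator R (snd u)) (first z, random_luroth z) \<partial>skew p)"
    by (intro nn_integral_cong) (auto split: split_indicator)
  also have "\<dots> = (\<integral>\<^sup>+c'. (\<integral>\<^sup>+z. indicator {c} c' * indicator R z \<partial>skew p) \<partial>letter_pmf p)"
  proof -
    have "(\<lambda>u. indicator {c} (fst u) :: ennreal) \<in> borel_measurable (count_space UNIV \<Otimes>\<^sub>M skew p)"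
      by (rule measurable_compose[OF measurable_fst]) simp
    moreover have "(\<lambda>u. indicator R (snd u) :: ennreal) \<in> borel_measurable (count_space UNIV \<Otimes>\<^sub>M skew p)"
      by (rule measurable_compose[OF measurable_snd borel_measurable_indicator[OF R]])
    ultimately have "(\<lambda>u. indicator {c} (fst u) * indicator R (snd u) :: ennreal) \<in> borel_measurable (count_space UNIV \<Otimes>\<^sub>M skew p)"
      by (rule borel_measurable_times_ennreal)
    from nn_integral_skew_step[OF this] show ?thesis by simp
  qed
  also have "\<dots> = (\<integral>\<^sup>+c'. indicator {c} c' * emeasure (skew p) R \<partial>letter_pmf p)"
    using R by (simp add: nn_integral_cmult)
  also have "\<dots> = ennreal (pmf (letter_pmf p) c) * emeasure (skew p) R"
    by (simp add: nn_integral_multc emeasure_pmf_single)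
  finally show ?case unfolding eq using Cons by (simp add: R_def mult.assoc)
qed

text \<open>A point that never reads b still never does so after \<open>length b\<close> steps, and
  it does not start with b. So N lies in its own preimage N' minus M. By invariance N' has the
  measure of N, and by independence M takes the positive proportion q of it.\<close>

lemma AE_reads:
  assumes p: "0 < p" "p < 1" and b: "\<forall>c\<in>set b. 2 \<le> snd c"
  shows "AE z in skew p. \<exists>k. reads b ((random_luroth ^^ k) z)"
proof -
  interpret S: prob_space "skew p" by (rule prob_space_skew)
  let ?F = random_luroth
  define q where "q = (\<Prod>c\<leftarrow>b. pmf (letter_pmf p) c)"
  have "pmf (letter_pmf p) c > 0" if "2 \<le> snd c" for c
    using that p by (cases c; cases "fst c") (auto simp: pmf_pair digit_prob_def)
  then have q: "0 < q" "ennreal q = (\<Prod>c\<leftarrow>b. ennreal (pmf (letter_pmf p) c))"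
    unfolding q_def using b by (induction b) (auto simp: ennreal_mult' less_imp_le)
  define N where "N = {z. \<forall>k. \<not> reads b ((?F ^^ k) z)}"
  have N: "N \<in> sets (skew p)"
  proof -
    have [measurable]: "Measurable.pred (skew p) (reads b)"
      using reads_sets[of b p] by (simp add: pred_def space_pair_measure)
    have "{z\<in>space (skew p). \<forall>k. \<not> reads b ((?F ^^ k) z)} \<in> sets (skew p)" by measurable
    then show ?thesis by (simp add: N_def space_pair_measure)
  qed
  define N' where "N' = {z. (?F ^^ length b) z \<in> N}"
  have vim: "N' = (?F ^^ length b) -` N \<inter> space (skew p)" by (auto simp: N'_def space_pair_measure)
  have N': "N' \<in> sets (skew p)" unfolding vim by (rule measurable_sets[OF _ N]) measurable
  define M where "M = {z. reads b z \<and> (?F ^^ length b) z \<in> N}"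
  have M: "M \<in> sets (skew p)" "M \<subseteq> N'"
    using sets.Int[OF reads_sets[of b p] N'] by (auto simp: M_def N'_def Int_def)
  have "emeasure (skew p) N' = emeasure (distr (skew p) (skew p) (?F ^^ length b)) N"
    unfolding vim by (rule emeasure_distr[symmetric, OF _ N]) measurable
  then have 1: "S.prob N' = S.prob N"
    unfolding distr_random_luroth_funpow by (simp add: measure_def)
  have "emeasure (skew p) M = ennreal q * emeasure (skew p) N"
    unfolding M_def q(2) by (rule emeasure_reads[OF N])
  then have 2: "S.prob M = q * S.prob N"
    using q(1) by (simp add: measure_def enn2real_mult)
  \<comment> \<open>Hence \<open>P(N) \<le> (1 - q) P(N)\<close>, which forces \<open>P(N) = 0\<close>.\<close>
  have "N \<subseteq> N' - M"
  proof
    fix z assume z: "z \<in> N"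
    have "\<not> reads b ((?F ^^ k) ((?F ^^ length b) z))" for k
      using z unfolding N_def by (simp flip: funpow_add[THEN fun_cong, unfolded comp_def])
    moreover have "\<not> reads b z" using z unfolding N_def by (auto dest: spec[of _ 0])
    ultimately show "z \<in> N' - M" by (simp add: N'_def M_def N_def)
  qed
  then have "S.prob N \<le> S.prob (N' - M)" using N' M by (intro S.finite_measure_mono) auto
  also have "\<dots> = S.prob N - q * S.prob N"
    using S.finite_measure_Diff[OF N' M] 1 2 by simp
  finally have "q * S.prob N \<le> 0" by simp
  then have "S.prob N = 0" using q(1) measure_nonneg[of "skew p" N] by (simp add: mult_le_0_iff)
  then have "N \<in> null_sets (skew p)" using N by (simp add: S.emeasure_eq_measure null_sets_def)
  from AE_not_in[OF this] show ?thesis by (auto simp: N_def)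
qed

text \<open>There are only countably many finite blocks, so their exceptional null sets can be
  united.\<close>

lemma AE_universal:
  assumes "0 < p" "p < 1"
  shows "AE z in skew p. universal (expansion (fst z) (snd z))"
proof -
  have "AE z in skew p. \<forall>b. (\<forall>c\<in>set b. 2 \<le> snd c) \<longrightarrow> (\<exists>k. reads b ((random_luroth ^^ k) z))"
    unfolding AE_all_countable using AE_reads[OF assms] by auto
  then show ?thesis
  proof eventually_elim
    case (elim z)
    have "first ((random_luroth ^^ j) ((random_luroth ^^ k) z)) = expansion (fst z) (snd z) (k + j)" for j k
      using skew_iterates(1)[of "j + k" "fst z" "snd z"] by (simp add: funpow_add add.commute)
    then show ?case using elim unfolding universal_def reads_def by fastforce
  qed
qed

section \<open>From the uniform law back to Lebesgue measure on [0,1]\<close>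

lemma measurable_lebesgue_on_unif: "(\<lambda>x. x) \<in> lebesgue_on {0..1} \<rightarrow>\<^sub>M unif"
proof -
  have "(\<lambda>x::real. x) \<in> lebesgue_on {0..1} \<rightarrow>\<^sub>M borel"
    by (intro measurable_restrict_space1 measurable_completion) simp
  then show ?thesis by simp
qed

lemma distr_lebesgue_on_unif: "distr (lebesgue_on {0..1}) unif (\<lambda>x. x) = unif"
proof (rule measure_eqI)
  fix A assume "A \<in> sets (distr (lebesgue_on {0..1}) unif (\<lambda>x. x))"
  then have A: "A \<in> sets borel" by simp
  have "emeasure (distr (lebesgue_on {0..1}) unif (\<lambda>x. x)) A = emeasure (lebesgue_on {0..1}) (A \<inter> {0..1})"
    using A by (subst emeasure_distr[OF measurable_lebesgue_on_unif]) (auto simp: Int_commute)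
  also have "\<dots> = emeasure lebesgue (A \<inter> {0..1})"
    by (rule emeasure_restrict_space) auto
  also have "\<dots> = emeasure lborel (A \<inter> {0..1})" using A by simp
  also have "\<dots> = emeasure lborel ({0<..<1} \<inter> A)"
  proof (rule emeasure_eq_AE)
    have "{0, 1::real} \<in> null_sets lborel" by (rule finite_imp_null_set_lborel) simp
    from AE_not_in[OF this] show "AE x in lborel. x \<in> A \<inter> {0..1} \<longleftrightarrow> x \<in> {0<..<1} \<inter> A"
      by eventually_elim auto
  qed (use A in auto)
  also have "\<dots> = emeasure unif A" using A by (simp add: divide_ennreal_def)
  finally show "emeasure (distr (lebesgue_on {0..1}) unif (\<lambda>x. x)) A = emeasure unif A" .
qed simp

lemma AE_lebesgue_on_if_unif:
  assumes "AE x in unif. Q x"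
  shows "AE x in lebesgue_on {0..1}. Q x"
  using AE_distrD[OF measurable_lebesgue_on_unif, of Q] assms unfolding distr_lebesgue_on_unif .

text \<open>The identity pushes \<open>luroth_measure p\<close> forward to \<open>skew p\<close>,
  because it does so in each factor. Null sets therefore have null preimages.\<close>

lemma AE_luroth_measure_if_skew:
  assumes "AE z in skew p. Q (fst z) (snd z)"
  shows "AE (\<omega>, x) in luroth_measure p. Q \<omega> x"
proof -
  interpret U: prob_space unif by (rule prob_space_unif)
  have "skew p = distr (bernoulli_measure p) (bernoulli_measure p) (\<lambda>\<omega>. \<omega>) \<Otimes>\<^sub>M distr (lebesgue_on {0..1}) unif (\<lambda>x. x)"
    by (simp add: distr_lebesgue_on_unif distr_id2)
  also have "\<dots> = distr (luroth_measure p) (skew p) (\<lambda>(\<omega>, x). (\<omega>, x))"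
    by (rule pair_measure_distr[OF _ measurable_lebesgue_on_unif])
       (simp_all add: distr_lebesgue_on_unif U.sigma_finite_measure_axioms)
  finally have eq: "distr (luroth_measure p) (skew p) (\<lambda>z. z) = skew p" by (simp add: case_prod_beta')
  have "(\<lambda>z. (fst z, snd z)) \<in> luroth_measure p \<rightarrow>\<^sub>M skew p"
    by (intro measurable_Pair measurable_compose[OF measurable_snd measurable_lebesgue_on_unif]) simp
  then have "(\<lambda>z. z) \<in> luroth_measure p \<rightarrow>\<^sub>M skew p" by simp
  from AE_distrD[OF this, of "\<lambda>z. Q (fst z) (snd z)"] assms
  show ?thesis unfolding eq by (simp add: case_prod_beta')
qed

section \<open>Uncountably many universal expansions\<close>

lemma stream_eq_nth:
  assumes "\<And>n. s !! n = t !! n"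
  shows "s = t"
proof -
  have "snth s = snth t" using assms by (intro ext)
  then show ?thesis using stream_smap_nats[of s] stream_smap_nats[of t] by simp
qed

text \<open>Removing the first symbol doubles the mass of a singleton, so after n removals the
  original mass is seen to be at most 2^(-n).\<close>

lemma bernoulli_half_singleton: "{\<omega>} \<in> null_sets (bernoulli_measure (1 / 2))"
proof -
  let ?B = "bernoulli_measure (1 / 2)"
  interpret B: prob_space ?B by (rule prob_space_bernoulli)
  have m: "{\<omega>} \<in> sets ?B" for \<omega> :: "bool stream"
  proof -
    have "{\<eta>\<in>space ?B. \<forall>n. \<eta> !! n = \<omega> !! n} \<in> sets ?B" by measurable
    moreover have "{\<eta>\<in>space ?B. \<forall>n. \<eta> !! n = \<omega> !! n} = {\<omega>}"
      by (auto simp: stream.map_ident intro: stream_eq_nth)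
    ultimately show ?thesis by simp
  qed
  have half: "emeasure ?B {\<omega>} = ennreal (1 / 2) * emeasure ?B {stl \<omega>}" for \<omega> :: "bool stream"
  proof -
    have "emeasure ?B {\<omega>} = (\<integral>\<^sup>+s. emeasure ?B {\<eta>\<in>space ?B. s ## \<eta> \<in> {\<omega>}} \<partial>bernoulli_pmf (1 - 1 / 2))"
      using m[of \<omega>] unfolding bernoulli_measure_def
      by (rule prob_space.emeasure_stream_space[OF measure_pmf.prob_space_axioms])
    also have "\<dots> = (\<integral>\<^sup>+s. indicator {shd \<omega>} s * emeasure ?B {stl \<omega>} \<partial>bernoulli_pmf (1 - 1 / 2))"
    proof (rule nn_integral_cong)
      fix s
      have "{\<eta>. s ## \<eta> = \<omega>} = (if s = shd \<omega> then {stl \<omega>} else {})"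
        by (cases \<omega>) auto
      then show "emeasure ?B {\<eta>\<in>space ?B. s ## \<eta> \<in> {\<omega>}} = indicator {shd \<omega>} s * emeasure ?B {stl \<omega>}"
        by simp
    qed
    also have "\<dots> = emeasure (bernoulli_pmf (1 - 1 / 2)) {shd \<omega>} * emeasure ?B {stl \<omega>}"
      by (subst nn_integral_multc) simp_all
    also have "\<dots> = ennreal (1 / 2) * emeasure ?B {stl \<omega>}"
      by (cases "shd \<omega>") (simp_all add: emeasure_pmf_single)
    finally show ?thesis .
  qed
  have "emeasure ?B {\<omega>} \<le> ennreal ((1 / 2) ^ n)" for n and \<omega> :: "bool stream"
  proof (induction n arbitrary: \<omega>)
    case 0
    then show ?case using B.emeasure_le_1 by simp
  next
    case (Suc n)
    have "emeasure ?B {\<omega>} \<le> ennreal (1 / 2) * ennreal ((1 / 2) ^ n)"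
      unfolding half[of \<omega>] by (intro mult_left_mono Suc) simp
    also have "\<dots> = ennreal ((1 / 2) ^ Suc n)" by (subst ennreal_mult[symmetric]) auto
    finally show ?case .
  qed
  then have "B.prob {\<omega>} \<le> (1 / 2) ^ n" for n
    by (simp add: B.emeasure_eq_measure)
  then have "B.prob {\<omega>} \<le> 0"
    by (intro LIMSEQ_le_const[OF LIMSEQ_realpow_zero[of "1 / 2"]]) auto
  then have "B.prob {\<omega>} = 0" using measure_nonneg[of ?B "{\<omega>}"] by linarith
  then show ?thesis using m by (simp add: B.emeasure_eq_measure null_sets_def)
qed

text \<open>The signs of an expansion record \<omega>, so distinct \<omega> give distinct
  expansions. Countably many universal ones would come from a countable, hence null, set of
  \<omega>, against its full measure.\<close>

lemma uncountable_universal: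
  assumes x: "0 < x" "x < 1" "x \<notin> \<rat>" and ae: "AE \<omega> in bernoulli_measure (1 / 2). universal (expansion \<omega> x)"
  shows "uncountable {e \<in> expansions x. universal e}"
proof
  interpret B: prob_space "bernoulli_measure (1 / 2)" by (rule prob_space_bernoulli)
  let ?\<Omega> = "{\<omega>. universal (expansion \<omega> x)}"
  assume count: "countable {e \<in> expansions x. universal e}"
  have "inj (\<lambda>\<omega>. expansion \<omega> x)"
  proof (rule injI)
    fix \<omega> \<eta> assume "expansion \<omega> x = expansion \<eta> x"
    then have "\<omega> !! i = \<eta> !! i" for i by (auto simp: expansion_def dest: fun_cong[of _ _ i])
    then show "\<omega> = \<eta>" by (rule stream_eq_nth)
  qed
  moreover have "(\<lambda>\<omega>. expansion \<omega> x) ` ?\<Omega> \<subseteq> {e \<in> expansions x. universal e}"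
    using expansion_in_expansions x by auto
  ultimately have "countable ?\<Omega>"
    using countable_image_inj_on[OF countable_subset[OF _ count] inj_on_subset] by blast
  then have "(\<Union>\<omega>\<in>?\<Omega>. {\<omega>}) \<in> null_sets (bernoulli_measure (1 / 2))"
    using bernoulli_half_singleton by (intro null_sets_UN') auto
  then have "AE \<omega> in bernoulli_measure (1 / 2). \<omega> \<notin> ?\<Omega>" using AE_not_in by force
  with ae have "AE \<omega> in bernoulli_measure (1 / 2). False" by eventually_elim auto
  then show False by simp
qed

lemma AE_uncountable_universal:
  "AE x in lebesgue_on {0..1}. uncountable {e \<in> expansions x. universal e}"
proof (rule AE_lebesgue_on_if_unif)
  interpret B: prob_space "bernoulli_measure (1 / 2)" by (rule prob_space_bernoulli)
  interpret U: prob_space unif by (rule prob_space_unif)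
  interpret P: pair_sigma_finite "bernoulli_measure (1 / 2)" unif ..
  interpret Q: pair_sigma_finite unif "bernoulli_measure (1 / 2)" ..
  \<comment> \<open>The claim about x does not mention p, so the symmetric measure may be used. The
    factors are swapped to make x the outer variable.\<close>
  have "AE z in distr (unif \<Otimes>\<^sub>M bernoulli_measure (1 / 2)) (skew (1 / 2)) (\<lambda>(x, y). (y, x)).
      universal (expansion (fst z) (snd z))"
    unfolding P.distr_pair_swap[symmetric] by (rule AE_universal) auto
  from AE_distrD[OF measurable_pair_swap' this]
  have "AE z in unif \<Otimes>\<^sub>M bernoulli_measure (1 / 2). universal (expansion (snd z) (fst z))"
    by (simp add: case_prod_beta')
  from Q.AE_pair[OF this] AE_unif show "AE x in unif. uncountable {e \<in> expansions x. universal e}"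
  proof eventually_elim
    case (elim x)
    then show ?case by (intro uncountable_universal) auto
  qed
qed

section \<open>Rates of convergence\<close>

text \<open>k inverse branches from place n on, applied to the arbitrary starting point 1/2; the
  limit in k is the tail at n.\<close>

primrec approx_tail :: "(nat \<Rightarrow> bool \<times> nat) \<Rightarrow> nat \<Rightarrow> nat \<Rightarrow> real" where
  "approx_tail e 0 n = 1 / 2"
| "approx_tail e (Suc k) n = branch (e n) (approx_tail e k (Suc n))"

lemma approx_tail_bounds: "0 \<le> approx_tail e k n \<and> approx_tail e k n \<le> 1"
  by (induction k arbitrary: n) (auto intro: bounded_branch[THEN conjunct1] bounded_branch[THEN conjunct2])

lemma branch_contraction:
  assumes "2 \<le> snd c"
  shows "\<bar>branch c y - branch c z\<bar> \<le> \<bar>y - z\<bar> / 2"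
proof -
  have w: "2 \<le> weight c" by (rule weight_ge_2[OF assms])
  then have "\<bar>branch c y - branch c z\<bar> = \<bar>y - z\<bar> / weight c"
    by (auto simp: branch_def diff_divide_distrib[symmetric] abs_divide abs_minus_commute)
  also have "\<dots> \<le> \<bar>y - z\<bar> / 2" using w by (intro divide_left_mono) auto
  finally show ?thesis .
qed

text \<open>Each inverse branch halves distances at least, so the approximations converge
  geometrically. The limit is a priori only nonnegative; being a branch value makes it
  positive.\<close>

lemma tails_exist:
  assumes "admissible e"
  obtains v where "tails e v"
proof -
  have d: "2 \<le> snd (e n)" for n using assms by (simp add: admissible_def)
  have step: "\<bar>approx_tail e (Suc k) n - approx_tail e k n\<bar> \<le> (1 / 2) ^ k" for k n
  proof (induction k arbitrary: n)
    case 0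
    show ?case using approx_tail_bounds[of e "Suc 0" n] by (simp add: abs_le_iff del: approx_tail.simps(2))
  next
    case (Suc k)
    have "\<bar>approx_tail e (Suc (Suc k)) n - approx_tail e (Suc k) n\<bar>
        \<le> \<bar>approx_tail e (Suc k) (Suc n) - approx_tail e k (Suc n)\<bar> / 2"
      using branch_contraction[OF d[of n]] by (simp only: approx_tail.simps)
    also have "\<dots> \<le> (1 / 2) ^ Suc k" using Suc[of "Suc n"] by simp
    finally show ?case .
  qed
  have "\<exists>l. (\<lambda>k. approx_tail e k n) \<longlonglongrightarrow> l" for n
  proof -
    have "summable (\<lambda>k. approx_tail e (Suc k) n - approx_tail e k n)"
      by (rule summable_comparison_test'[OF summable_geometric[of "1 / 2 :: real"]])
         (use step in auto)
    from summable_LIMSEQ[OF this]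
    have "(\<lambda>k. approx_tail e k n - approx_tail e 0 n) \<longlonglongrightarrow> (\<Sum>k. approx_tail e (Suc k) n - approx_tail e k n)"
      by (simp only: sum_lessThan_telescope[of "\<lambda>k. approx_tail e k n"])
    from tendsto_add[OF this tendsto_const[of "approx_tail e 0 n"]] show ?thesis by auto
  qed
  then obtain v where v: "\<And>n. (\<lambda>k. approx_tail e k n) \<longlonglongrightarrow> v n" by metis
  have b: "0 \<le> v n" "v n \<le> 1" for n
    using approx_tail_bounds by (auto intro: LIMSEQ_le_const[OF v] LIMSEQ_le_const2[OF v])
  have rec: "v n = branch (e n) (v (Suc n))" for n
  proof (rule LIMSEQ_unique)
    show "(\<lambda>k. approx_tail e (Suc k) n) \<longlonglongrightarrow> v n" by (rule LIMSEQ_Suc[OF v])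
    have "(\<lambda>k. branch (e n) (approx_tail e k (Suc n))) \<longlonglongrightarrow> branch (e n) (v (Suc n))"
      using weight_ge_2[OF d[of n]] unfolding branch_def by (cases "fst (e n)") (auto intro!: tendsto_intros v)
    then show "(\<lambda>k. approx_tail e (Suc k) n) \<longlonglongrightarrow> branch (e n) (v (Suc n))" by simp
  qed
  have "0 < v n" for n
  proof -
    have "0 < 1 / real (snd (e n))" using d[of n] by simp
    also have "\<dots> \<le> v n" unfolding rec[of n] by (intro branch_pos d b)
    finally show ?thesis .
  qed
  then show thesis using rec b that unfolding tails_def by blast
qed

text \<open>With all signs equal to 1 no tail can be 0 or 1, so the orbit avoids the points \<open>1/n\<close> at which
  the fibre maps were redefined.\<close>

lemma alternating_realisation:
  assumes d: "\<And>n. 2 \<le> d n"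
  obtains x where "0 < x" "x < 1" "(\<lambda>n. (True, d n)) \<in> expansions x" "\<forall>v. tails (\<lambda>n. (True, d n)) v \<longrightarrow> v 0 = x"
proof -
  let ?e = "\<lambda>n. (True, d n)"
  have e: "admissible ?e" using d by (simp add: admissible_def)
  obtain v where v: "tails ?e v" using tails_exist[OF e] .
  have rec: "v n = branch (True, d n) (v (Suc n))" for n using v unfolding tails_def by blast
  have v1: "v n \<in> {0<..<1}" for n
  proof -
    have dd: "2 \<le> real (d n)" using d[of n] by simp
    \<comment> \<open>With sign 1 the numerator is d - v (n + 1), strictly below d. With sign 0 and
      all digits 2 the tails would be constantly 1, a redefined point.\<close>
    have "v n = (real (d n) - v (Suc n)) / (real (d n) * (real (d n) - 1))"
      unfolding rec[of n] by (simp add: branch_def weight_def)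
    also have "\<dots> < real (d n) / (real (d n) * (real (d n) - 1))"
      using tails_pos[OF v, of "Suc n"] dd by (intro divide_strict_right_mono) auto
    also have "\<dots> \<le> 1" using dd by (simp add: divide_simps)
    finally show ?thesis using tails_pos[OF v, of n] by simp
  qed
  have orb: "orbit (smap (\<lambda>_. True) nats) n (v 0) = v n" for n
  proof (induction n)
    case (Suc n)
    have "fibre_map True (v n) = v (Suc n)"
      using branch_digit(2)[of "(True, d n)" "v (Suc n)"] d[of n] v1[of "Suc n"] rec[of n] by simp
    then show ?case using Suc by simp
  qed simp
  have dig: "digit (v n) = d n" for n
    using branch_digit(1)[of "(True, d n)" "v (Suc n)"] d[of n] v1[of "Suc n"] rec[of n] by simp
  have ex: "expansion (smap (\<lambda>_. True) nats) (v 0) = ?e" by (simp add: expansion_def orb dig)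
  have lim: "convergent_of ?e \<longlonglongrightarrow> v 0" by (rule tails_imp_convergent[OF e v])
  have "?e \<in> expansions (v 0)" unfolding expansions_def mem_Collect_eq
    by (rule exI[of _ "smap (\<lambda>_. True) nats"]) (simp only: ex lim)
  moreover have "w 0 = v 0" if "tails ?e w" for w
    using tails_imp_convergent[OF e that] lim by (rule LIMSEQ_unique)
  ultimately show thesis using that[of "v 0"] v1[of 0] by auto
qed

lemma floor_multiple_average:
  fixes a :: real
  shows "(\<lambda>n. of_int \<lfloor>a * real n\<rfloor> / real n) \<longlonglongrightarrow> a"
proof (rule tendsto_sandwich)
  show "eventually (\<lambda>n. a - 1 / real n \<le> of_int \<lfloor>a * real n\<rfloor> / real n) sequentially"
    using eventually_gt_at_top[of 0]
  proof eventually_elim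
    case (elim n)
    have "a * real n - 1 \<le> of_int \<lfloor>a * real n\<rfloor>" by linarith
    then have "(a * real n - 1) / real n \<le> of_int \<lfloor>a * real n\<rfloor> / real n"
      by (intro divide_right_mono) auto
    then show ?case using elim by (simp add: diff_divide_distrib)
  qed
  show "eventually (\<lambda>n. of_int \<lfloor>a * real n\<rfloor> / real n \<le> a) sequentially"
    using eventually_gt_at_top[of 0] by eventually_elim (simp add: divide_le_eq)
  have "(\<lambda>n. 1 / real n) \<longlonglongrightarrow> 0" by real_asymp
  from tendsto_diff[OF tendsto_const[of a] this] show "(\<lambda>n. a - 1 / real n) \<longlonglongrightarrow> a" by simp
qed simp

lemma rate_attained:
  assumes "r \<le> - ln 2"
  shows "\<exists>x\<in>{0<..1}. \<exists>e\<in>expansions x. converges_at_rate e x r"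
proof -
  \<comment> \<open>D is so large that -r < ln (D (D - 1)). L is the gain of a digit D over a digit
    2, and a < 1 is the frequency of D for which ln 2 + L a = -r.\<close>
  define D where "D = nat \<lceil>exp (- r)\<rceil> + 2"
  define L where "L = ln (real D * (real D - 1)) - ln 2"
  define a where "a = (- r - ln 2) / L"
  have D2: "2 \<le> D" by (simp add: D_def)
  have "exp (- r) < real D" unfolding D_def by linarith
  moreover have "real D * 1 \<le> real D * (real D - 1)" using D2 by (intro mult_left_mono) auto
  ultimately have "exp (- r) < real D * (real D - 1)" by linarith
  then have "- r < ln (real D * (real D - 1))"
    by (metis exp_gt_zero less_trans ln_exp ln_less_cancel_iff)
  then have L: "0 < L" "- r - ln 2 < L" using assms by (auto simp: L_def)
  then have a: "0 \<le> a" "a < 1" using assms by (simp_all add: a_def)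
  define f where "f n = \<lfloor>a * real n\<rfloor>" for n
  \<comment> \<open>D stands where the floor of a n jumps, so the first n places contain exactly
    that many copies of D. As a < 1, each jump is by one.\<close>
  define d where "d n = (if f (Suc n) = f n then 2 else D)" for n
  have inc: "f (Suc n) = f n \<or> f (Suc n) = f n + 1" for n
  proof -
    have "a * real (Suc n) = a * real n + a" by (simp add: algebra_simps)
    then show ?thesis using a unfolding f_def by linarith
  qed
  have w: "ln (weight (True, d n)) = ln 2 + L * of_int (f (Suc n) - f n)" for n
    using inc[of n] by (auto simp: d_def weight_def L_def)
  have sumw: "(\<Sum>i<n. ln (weight (True, d i))) = real n * ln 2 + L * of_int (f n)" for n
  proof (induction n)
    case (Suc n)
    then show ?case by (simp add: w algebra_simps)
  qed (simp add: f_def)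
  have "(\<lambda>n. ln 2 + L * (of_int (f n) / real n)) \<longlonglongrightarrow> ln 2 + L * a"
    unfolding f_def by (intro tendsto_intros floor_multiple_average)
  moreover have "eventually (\<lambda>n. ln 2 + L * (of_int (f n) / real n) = (\<Sum>i<n. ln (weight (True, d i))) / real n) sequentially"
    using eventually_gt_at_top[of 0] by eventually_elim (simp add: sumw add_divide_distrib)
  ultimately have lim: "(\<lambda>n. (\<Sum>i<n. ln (weight (True, d i))) / real n) \<longlonglongrightarrow> - r"
    using L by (simp add: tendsto_cong a_def)
  have d2: "2 \<le> d n" for n using D2 by (simp add: d_def)
  then have e: "admissible (\<lambda>n. (True, d n))" by (simp add: admissible_def)
  obtain v where v: "tails (\<lambda>n. (True, d n)) v" using tails_exist[OF e] .
  obtain x where x: "0 < x" "x < 1" "(\<lambda>n. (True, d n)) \<in> expansions x"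
    "\<forall>v. tails (\<lambda>n. (True, d n)) v \<longrightarrow> v 0 = x"
    using alternating_realisation[of d, OF d2] .
  have "converges_at_rate (\<lambda>n. (True, d n)) x r"
    using rate_of_mean_log[OF e v lim] x(4) v by simp
  then show ?thesis using x by (intro bexI[of _ x] bexI[of _ "\<lambda>n. (True, d n)"]) auto
qed

text \<open>All weights are at least 2 and tails at most 1, so the n-th error is at most 2^(-n). The
  tails come from convergence of the series, which covers rational x as well.\<close>

lemma rate_upper_bound:
  assumes x: "0 < x" "x \<le> 1" and e: "e \<in> expansions x" and r: "converges_at_rate e x r"
  shows "r \<le> - ln 2"
proof -
  have a: "admissible e" and lim: "convergent_of e \<longlonglongrightarrow> x"
    using e expansion_admissible[OF x] by (auto simp: expansions_def)
  obtain v where v: "v 0 = x" "tails e v" using convergent_imp_tails[OF a lim] .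
  have bd: "1 / real n * ln \<bar>x - convergent_of e n\<bar> \<le> - ln 2" if "1 \<le> n" for n
  proof -
    have W: "2 ^ n \<le> weight_upto e n" "0 < weight_upto e n"
      by (rule weight_upto_ge[OF a], rule weight_upto_pos[OF a])
    have "v n / weight_upto e n \<le> 1 / 2 ^ n"
      using W tails_pos[OF v(2), of n] by (intro frac_le) auto
    then have "ln (v n / weight_upto e n) \<le> ln (1 / 2 ^ n)"
      using W(2) tails_pos[OF v(2), of n] by (subst ln_le_cancel_iff) auto
    also have "\<dots> = - (real n * ln 2)" by (simp add: ln_div ln_realpow)
    finally have "ln \<bar>x - convergent_of e n\<bar> \<le> - (real n * ln 2)"
      using convergent_error[OF a v(2), of n] v(1) by simp
    from mult_left_mono[OF this, of "1 / real n"] show ?thesis using that by simp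
  qed
  show ?thesis
    using r unfolding converges_at_rate_def
    by (rule LIMSEQ_le_const2) (use bd in blast)
qed

section \<open>The range of the mean approximation coefficient\<close>

lemma zeta_2_gt: "3 / 2 < zeta 2"
proof -
  \<comment> \<open>Seven is the least number of terms whose sum exceeds 3/2.\<close>
  have "3 / 2 < (\<Sum>n<7. 1 / (real (Suc n))\<^sup>2)"
    by (simp add: eval_nat_numeral)
  also have "\<dots> \<le> zeta 2"
    unfolding sums_unique[OF zeta_2_sums]
    by (rule sum_le_suminf[OF sums_summable[OF zeta_2_sums]]) auto
  finally show ?thesis .
qed

lemma AE_luroth_approx_coeff:
  assumes "0 \<le> p" "p \<le> 1"
  shows "AE (\<omega>, x) in luroth_measure p. (\<lambda>n. 1 / real n * (\<Sum>i = 1..n. approx_coeff \<omega> x i))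
    \<longlonglongrightarrow> p * ((2 * zeta 2 - 3) / 2) + (2 - zeta 2) / 2"
  using AE_luroth_measure_if_skew[OF AE_approx_coeff[OF assms]] .

text \<open>The limit is affine in p, namely \<open>M_A\<close> + p K with K = \<open>M_L\<close> -
  \<open>M_A\<close>, and K > 0 because \<open>zeta 2\<close> exceeds 3/2. The strict clauses serve
  the open interval of values.\<close>

lemma limit_attained:
  assumes "M_A \<le> v" "v \<le> M_L"
  obtains p where "0 \<le> p" "p \<le> 1" "M_A < v \<longrightarrow> 0 < p" "v < M_L \<longrightarrow> p < 1"
    "v = p * ((2 * zeta 2 - 3) / 2) + (2 - zeta 2) / 2"
proof -
  define K where "K = zeta 2 - 3 / 2"
  define p where "p = (v - M_A) / K"
  have K: "0 < K" using zeta_2_gt by (simp add: K_def)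
  then have v: "v = p * K + M_A" by (simp add: p_def)
  have "M_L = M_A + K" by (simp add: M_A_def M_L_def K_def field_simps)
  then have "0 \<le> p" "p \<le> 1" "M_A < v \<longrightarrow> 0 < p" "v < M_L \<longrightarrow> p < 1"
    using K assms unfolding p_def by auto
  moreover have "v = p * ((2 * zeta 2 - 3) / 2) + (2 - zeta 2) / 2"
    unfolding v M_A_def K_def by (simp add: field_simps)
  ultimately show thesis by (rule that)
qed

text \<open>Attainment is stated twice because the end points \<open>M_A\<close> and
  \<open>M_L\<close> belong to p' = 0 and p' = 1, where a single fibre map is applied almost surely.
  The rates range over x > 0, since digits are defined for nonzero x.\<close>

theorem theorem2:
  fixes p :: real
  assumes "0 < p" and "p < 1"
  shows
    "(AE x in lebesgue_on {0..1}. uncountable {e \<in> expansions x. universal e})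
     \<and>
     (AE (\<omega>, x) in luroth_measure p.
        converges_at_rate (expansion \<omega> x) x
          (- (\<Sum>\<^sub>\<infinity>d\<in>{2::nat..}. ln (real d * (real d - 1)) / (real d * (real d - 1)))))
     \<and>
     {r. \<exists>x\<in>{0<..1}. \<exists>e\<in>expansions x. converges_at_rate e x r} = {.. - ln 2}
     \<and>
     (AE (\<omega>, x) in luroth_measure p.
        (\<lambda>n. 1 / real n * (\<Sum>i = 1..n. approx_coeff \<omega> x i))
          \<longlonglongrightarrow> p * ((2 * zeta 2 - 3) / 2) + (2 - zeta 2) / 2)
     \<and>
     (\<forall>v\<in>{M_A<..<M_L}. \<exists>p'\<in>{0<..<1}. AE (\<omega>, x) in luroth_measure p'.
        (\<lambda>n. 1 / real n * (\<Sum>i = 1..n. approx_coeff \<omega> x i)) \<longlonglongrightarrow> v)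
     \<and>
     (\<forall>v\<in>{M_A..M_L}. \<exists>p'\<in>{0..1}. AE (\<omega>, x) in luroth_measure p'.
        (\<lambda>n. 1 / real n * (\<Sum>i = 1..n. approx_coeff \<omega> x i)) \<longlonglongrightarrow> v)"
proof (intro conjI)
  show "AE x in lebesgue_on {0..1}. uncountable {e \<in> expansions x. universal e}"
    by (rule AE_uncountable_universal)
  show "AE (\<omega>, x) in luroth_measure p.
        converges_at_rate (expansion \<omega> x) x
          (- (\<Sum>\<^sub>\<infinity>d\<in>{2::nat..}. ln (real d * (real d - 1)) / (real d * (real d - 1))))"
    using AE_luroth_measure_if_skew[OF AE_rate] unfolding mean_log_def .
  show "{r. \<exists>x\<in>{0<..1}. \<exists>e\<in>expansions x. converges_at_rate e x r} = {.. - ln 2}"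
    using rate_upper_bound rate_attained by auto
  show "AE (\<omega>, x) in luroth_measure p.
        (\<lambda>n. 1 / real n * (\<Sum>i = 1..n. approx_coeff \<omega> x i))
          \<longlonglongrightarrow> p * ((2 * zeta 2 - 3) / 2) + (2 - zeta 2) / 2"
    using assms by (intro AE_luroth_approx_coeff) auto
  show "\<forall>v\<in>{M_A<..<M_L}. \<exists>p'\<in>{0<..<1}. AE (\<omega>, x) in luroth_measure p'.
        (\<lambda>n. 1 / real n * (\<Sum>i = 1..n. approx_coeff \<omega> x i)) \<longlonglongrightarrow> v"
  proof
    fix v assume v: "v \<in> {M_A<..<M_L}"
    then have "M_A \<le> v" "v \<le> M_L" by auto
    from limit_attained[OF this] obtain q where q: "0 \<le> q" "q \<le> 1" "M_A < v \<longrightarrow> 0 < q" "v < M_L \<longrightarrow> q < 1"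
      "v = q * ((2 * zeta 2 - 3) / 2) + (2 - zeta 2) / 2" .
    show "\<exists>p'\<in>{0<..<1}. AE (\<omega>, x) in luroth_measure p'.
        (\<lambda>n. 1 / real n * (\<Sum>i = 1..n. approx_coeff \<omega> x i)) \<longlonglongrightarrow> v"
      using AE_luroth_approx_coeff[OF q(1,2)] unfolding q(5)[symmetric]
      by (rule bexI) (use q v in auto)
  qed
  show "\<forall>v\<in>{M_A..M_L}. \<exists>p'\<in>{0..1}. AE (\<omega>, x) in luroth_measure p'.
        (\<lambda>n. 1 / real n * (\<Sum>i = 1..n. approx_coeff \<omega> x i)) \<longlonglongrightarrow> v"
  proof
    fix v assume v: "v \<in> {M_A..M_L}"
    then have "M_A \<le> v" "v \<le> M_L" by auto
    from limit_attained[OF this] obtain q where q: "0 \<le> q" "q \<le> 1" "M_A < v \<longrightarrow> 0 < q" "v < M_L \<longrightarrow> q < 1"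
      "v = q * ((2 * zeta 2 - 3) / 2) + (2 - zeta 2) / 2" .
    show "\<exists>p'\<in>{0..1}. AE (\<omega>, x) in luroth_measure p'.
        (\<lambda>n. 1 / real n * (\<Sum>i = 1..n. approx_coeff \<omega> x i)) \<longlonglongrightarrow> v"
      using AE_luroth_approx_coeff[OF q(1,2)] unfolding q(5)[symmetric]
      by (rule bexI) (use q v in auto)
  qed
qed

end
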